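(* Let $p\in\mathbb{N}$ and let $w_p$ be a polynomial with complex coefficients of degree $p$ satisfying $w_p(n)>0$ for every $n\in\mathbb{N}_0$ and $w_p(0)=1$. Then the sequence $m=(m(n))_{n\ge0}$ defined by $m(n)=w_p(n)$ for every $n\in\mathbb{N}_0$ preserves summability.
   Context: Let $\mathbb{E}$ be a complex Banach space with norm $\|\cdot\|_{\mathbb{E}}$, and $\mathbb{E}[[t]]$ the space of formal power series with coefficients in $\mathbb{E}$. For a direction $d\in\mathbb{R}$ and $\alpha,r>0$ put $S_d(\alpha)=\{\rho e^{i\phi}:\rho>0,\ \phi\in(d-\alpha/2,d+\alpha/2)\}$, $D_r=\{z\in\mathbb{C}:|z|<r\}$, and let $\hat S_d(\alpha,r)=S_d(\alpha)\cup D_r$ (a disc-sector in direction $d$, written $\hat S_d$ when $\alpha,r$ are not essential). For $k>0$, $\mathcal{O}^k(\hat S_d(\alpha,r),\mathbb{E})$ is the set of holomorphic $f:\hat S_d(\alpha,r)\to\mathbb{E}$ such that for all $\tilde\alpha\in(0,\alpha)$, $\tilde r\in(0,r)$ there are $A,B>0$ with $\|f(t)\|_{\mathbb{E}}<Ae^{B|t|^k}$ for all $t\in\hat S_d(\tilde\alpha,\tilde r)$. For a power series, membership in this set means that it converges near $0$ and its sum extends analytically to such a function. For a sequence $m$ of positive numbers, the $m$-Borel operator $\mathcal{B}_m:\mathbb{E}[[t]]\to\mathbb{E}[[t]]$ is $\mathcal{B}_m(\sum_{n\ge0} a_nt^n)=\sum_{n\ge0}\frac{a_n}{m(n)}t^n$.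 Put $\Gamma_{1/k}=(\Gamma(1+n/k))_{n\ge0}$. A series $\hat u\in\mathbb{E}[[t]]$ is $k$-summable in direction $d$ (written $\hat u\in\mathbb{E}\{t\}_{k,d}$) if there is a disc-sector $\hat S_d$ in direction $d$ with $\mathcal{B}_{\Gamma_{1/k}}\hat u\in\mathcal{O}^k(\hat S_d,\mathbb{E})$. A sequence $m$ of positive numbers preserves summability if for every $k>0$, $d\in\mathbb{R}$ and $\hat u\in\mathbb{E}[[t]]$: $\hat u\in\mathbb{E}\{t\}_{k,d}$ if and only if $\mathcal{B}_m\hat u\in\mathbb{E}\{t\}_{k,d}$. *)

theory Defs
  imports "HOL-Complex_Analysis.Complex_Analysis"
begin

class complex_banach = banach +
  fixes scaleC :: "complex \<Rightarrow> 'a \<Rightarrow> 'a"  (infixr "*\<^sub>C" 75)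
  assumes scaleC_add_right: "a *\<^sub>C (x + y) = a *\<^sub>C x + a *\<^sub>C y"
    and scaleC_add_left: "(a + b) *\<^sub>C x = a *\<^sub>C x + b *\<^sub>C x"
    and scaleC_scaleC: "a *\<^sub>C b *\<^sub>C x = (a * b) *\<^sub>C x"
    and scaleC_of_real: "complex_of_real s *\<^sub>C x = s *\<^sub>R x"
    and norm_scaleC: "norm (a *\<^sub>C x) = cmod a * norm x"

instantiation complex :: complex_banach
begin

definition scaleC_complex :: "complex \<Rightarrow> complex \<Rightarrow> complex"
  where "scaleC_complex a x = a * x"

instance
  by standard
    (simp_all add: scaleC_complex_def algebra_simps norm_mult scaleR_conv_of_real)

end

text \<open>
  The library predicate \<open>holomorphic_on\<close> only covers complex-valued functions. This is its
  vector-valued analogue: a complex-linear Frechet derivative exists at every point.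
\<close>

definition vholomorphic_on :: "(complex \<Rightarrow> 'e::complex_banach) \<Rightarrow> complex set \<Rightarrow> bool"
    (infixl "vholomorphic'_on" 50)
  where "f vholomorphic_on S \<longleftrightarrow>
    (\<forall>z\<in>S. \<exists>D. (f has_derivative (\<lambda>h. h *\<^sub>C D)) (at z within S))"

lemma vholomorphic_on_complex_iff:
  fixes f :: "complex \<Rightarrow> complex"
  shows "f vholomorphic_on S \<longleftrightarrow> f holomorphic_on S"
proof -
  have "(\<lambda>h. h *\<^sub>C D) = (*) D" for D :: complex
    by (simp add: scaleC_complex_def fun_eq_iff)
  then show ?thesis
    by (simp add: vholomorphic_on_def holomorphic_on_def field_differentiable_def
        has_field_derivative_def)
qed

definition sector :: "real \<Rightarrow> real \<Rightarrow> complex set"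
  where "sector d \<alpha> = {rcis \<rho> \<phi> | \<rho> \<phi>. 0 < \<rho> \<and> \<phi> \<in> {d - \<alpha> / 2 <..< d + \<alpha> / 2}}"

definition disc_sector :: "real \<Rightarrow> real \<Rightarrow> real \<Rightarrow> complex set"
  where "disc_sector d \<alpha> r = sector d \<alpha> \<union> ball 0 r"

definition exp_growth_holomorphic ::
    "real \<Rightarrow> real \<Rightarrow> real \<Rightarrow> real \<Rightarrow> (complex \<Rightarrow> 'e::complex_banach) set"
  where "exp_growth_holomorphic k d \<alpha> r =
    {f. f vholomorphic_on disc_sector d \<alpha> r \<and>
        (\<forall>\<alpha>'\<in>{0<..<\<alpha>}. \<forall>r'\<in>{0<..<r}. \<exists>A>0. \<exists>B>0. \<forall>t\<in>disc_sector d \<alpha>' r'.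
           norm (f t) < A * exp (B * cmod t powr k))}"

text \<open>
  A power series belongs to the above class if it converges near the origin and its sum there
  is the germ of some member of the class.
\<close>

definition fps_exp_growth ::
    "real \<Rightarrow> real \<Rightarrow> real \<Rightarrow> real \<Rightarrow> 'e::complex_banach fps \<Rightarrow> bool"
  where "fps_exp_growth k d \<alpha> r u \<longleftrightarrow>
    (\<exists>f\<in>exp_growth_holomorphic k d \<alpha> r. \<exists>\<epsilon>>0. \<forall>t\<in>ball 0 \<epsilon>.
       (\<lambda>n. t ^ n *\<^sub>C fps_nth u n) sums f t)"

definition moment_borel :: "(nat \<Rightarrow> real) \<Rightarrow> 'e::complex_banach fps \<Rightarrow> 'e fps"
  where "moment_borel m u = Abs_fps (\<lambda>n. (1 / m n) *\<^sub>R fps_nth u n)"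

definition summable_dir :: "real \<Rightarrow> real \<Rightarrow> 'e::complex_banach fps \<Rightarrow> bool"
  where "summable_dir k d u \<longleftrightarrow>
    (\<exists>\<alpha>>0. \<exists>r>0. fps_exp_growth k d \<alpha> r (moment_borel (\<lambda>n. Gamma (1 + real n / k)) u))"

text \<open>The type argument fixes the Banach space of coefficients.\<close>

definition preserves_summability :: "'e::complex_banach itself \<Rightarrow> (nat \<Rightarrow> real) \<Rightarrow> bool"
  where "preserves_summability _ m \<longleftrightarrow>
    (\<forall>n. 0 < m n) \<and>
    (\<forall>k>0. \<forall>d. \<forall>u :: 'e fps. summable_dir k d u \<longleftrightarrow> summable_dir k d (moment_borel m u))"

end

theory Submission
  imports Defs "HOL-Computational_Algebra.Fundamental_Theorem_Algebra"
begin

text \<open>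
  Factoring \<open>w\<close> into linear factors, it suffices that multiplying and dividing the coefficients of
  the Borel transform \<open>f\<close> by \<open>n - \<mu>\<close> (for \<open>\<mu>\<close> not a natural number) preserves the class of
  functions of exponential growth on a disc-sector. Both operations have the form
  \<open>t \<mapsto> \<integral> a(s) f(q(s) t) ds\<close>, which acts on coefficients as multiplication by \<open>\<integral> a(s) q(s)\<^sup>n ds\<close>
  and visibly preserves the class if all \<open>q(s)\<close> lie in \<open>[0, 1]\<close> or close to \<open>1\<close>: for the product take
  \<open>q\<close> to be a small circle around \<open>1\<close> (Cauchy's formula), for the quotient take \<open>q(s) = s\<close> and
  \<open>a(s) = s powr (- \<mu> - 1)\<close>. The latter requires \<open>\<mu>\<close> to lie in a left half plane, which is
  achieved by passing to \<open>(f(t) - f(0)) / t\<close> finitely often.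
\<close>

section \<open>Norming functionals\<close>

text \<open>For positive factors only one inequality is demanded. Applied to \<open>c\<close> and to
  \<open>1/c\<close> it gives equality, and infima of functionals inherit the inequality
  easily.\<close>

definition sublinear :: "('a::real_vector \<Rightarrow> real) \<Rightarrow> bool"
  where "sublinear p \<longleftrightarrow> (\<forall>x y. p (x + y) \<le> p x + p y) \<and> (\<forall>c>0. \<forall>x. p (c *\<^sub>R x) \<le> c * p x)"

lemma sublinearI:
  assumes "\<And>x y. p (x + y) \<le> p x + p y" "\<And>c x. c > 0 \<Longrightarrow> p (c *\<^sub>R x) \<le> c * p x"
  shows "sublinear p"
  using assms by (simp add: sublinear_def)

lemma sublinear_add: "sublinear p \<Longrightarrow> p (x + y) \<le> p x + p y"
  by (simp add: sublinear_def)

lemma sublinear_zero: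
  assumes "sublinear p" shows "p 0 = 0"
proof -
  have "p (0 + 0) \<le> p 0 + p 0" "p ((1/2) *\<^sub>R 0) \<le> (1/2) * p 0"
    using assms unfolding sublinear_def by (blast, (metis half_gt_zero zero_less_one))
  then show ?thesis by simp
qed

lemma sublinear_scaleR:
  assumes "sublinear p" "c \<ge> 0" shows "p (c *\<^sub>R x) = c * p x"
proof (cases "c = 0")
  case True
  then show ?thesis using sublinear_zero[OF assms(1)] by simp
next
  case False
  then have c: "c > 0" using assms by simp
  have "p ((1/c) *\<^sub>R (c *\<^sub>R x)) \<le> (1/c) * p (c *\<^sub>R x)"
    using assms(1) c unfolding sublinear_def by (metis zero_less_divide_1_iff)
  then have "c * p x \<le> p (c *\<^sub>R x)" using c by (simp add: field_simps)
  moreover have "p (c *\<^sub>R x) \<le> c * p x" using assms(1) c by (simp add: sublinear_def)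
  ultimately show ?thesis by simp
qed

lemma sublinear_minus:
  assumes "sublinear p" shows "- p (- x) \<le> p x"
  using sublinear_add[OF assms, of x "- x"] sublinear_zero[OF assms] by simp

text \<open>This is the Hahn-Banach descent: \<open>q x\<close> is the infimum of
  \<open>p (x + t *\<^sub>R y) - t * p y\<close> over \<open>t \<ge> 0\<close>. The value
  \<open>t = 0\<close> gives \<open>q \<le> p\<close>, and \<open>t = 1\<close> at
  \<open>- y\<close> gives the last claim because \<open>p 0 = 0\<close>.\<close>

lemma sublinear_descend:
  fixes p :: "'a::real_vector \<Rightarrow> real"
  assumes "sublinear p"
  obtains q where "sublinear q" "q \<le> p" "q (- y) \<le> - p y"
proof -
  define T where "T t x = p (x + t *\<^sub>R y) - t * p y" for t x
  define q where "q x = (INF t\<in>{0..}. T t x)" for x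
  \<comment> \<open>A lower bound independent of \<open>t\<close>, so the infimum is a real number:
    \<open>t * p y = p (t *\<^sub>R y)\<close> is at most
    \<open>p (x + t *\<^sub>R y) + p (- x)\<close>.\<close>
  have lower: "- p (- x) \<le> T t x" if "t \<ge> 0" for t x
    using sublinear_add[OF assms, of "x + t *\<^sub>R y" "- x"] sublinear_scaleR[OF assms that, of y]
    by (simp add: T_def)
  have bdd: "bdd_below ((\<lambda>t. T t x) ` {0..})" for x
    using lower by (intro bdd_belowI[of _ "- p (- x)"]) auto
  have le: "q x \<le> T t x" if "t \<ge> 0" for t x
    unfolding q_def using that by (intro cINF_lower[OF bdd]) auto
  have ge: "z \<le> q x" if "\<And>t. t \<ge> 0 \<Longrightarrow> z \<le> T t x" for z x
    unfolding q_def using that by (intro cINF_greatest) auto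
  have "sublinear q"
  proof (rule sublinearI)
    fix x x'
    \<comment> \<open>The two summands keep independent parameters and are compared with
      \<open>t + t'\<close>; the infimum is then taken in one parameter after the other.\<close>
    have *: "q (x + x') \<le> T t x + T t' x'" if "t \<ge> 0" "t' \<ge> 0" for t t'
    proof -
      have "q (x + x') \<le> T (t + t') (x + x')" using that by (intro le) auto
      also have "\<dots> \<le> T t x + T t' x'"
        using sublinear_add[OF assms, of "x + t *\<^sub>R y" "x' + t' *\<^sub>R y"]
        by (simp add: T_def algebra_simps)
      finally show ?thesis .
    qed
    have "q (x + x') - T t' x' \<le> q x" if "t' \<ge> 0" for t'
      by (rule ge) (use *[OF _ that] in \<open>simp add: algebra_simps\<close>)
    then have "q (x + x') - q x \<le> q x'"
      by (intro ge) (simp add: algebra_simps)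
    then show "q (x + x') \<le> q x + q x'" by simp
  next
    fix c :: real and x assume c: "c > 0"
    have "q (c *\<^sub>R x) / c \<le> T t x" if "t \<ge> 0" for t
    proof -
      have "q (c *\<^sub>R x) \<le> T (c * t) (c *\<^sub>R x)" using c that by (intro le) auto
      also have "\<dots> = c * T t x"
        using sublinear_scaleR[OF assms, of c "x + t *\<^sub>R y"] c
        by (simp add: T_def algebra_simps)
      finally show ?thesis using c by (simp add: field_simps)
    qed
    then have "q (c *\<^sub>R x) / c \<le> q x" by (rule ge)
    then show "q (c *\<^sub>R x) \<le> c * q x" using c by (simp add: field_simps)
  qed
  moreover have "q \<le> p" using le[of 0] by (simp add: le_fun_def T_def)
  moreover have "q (- y) \<le> - p y"
    using le[of 1 "- y"] sublinear_zero[OF assms] by (simp add: T_def)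
  ultimately show thesis by (rule that)
qed

text \<open>Provides the bound needed for Zorn's lemma, as a pointwise infimum. The common majorant
  \<open>p0\<close> keeps it finite, because
  \<open>- p0 (- x) \<le> - p (- x) \<le> p x\<close>.\<close>

lemma sublinear_Inf_chain:
  fixes C :: "('a::real_vector \<Rightarrow> real) set"
  assumes "C \<noteq> {}" and sub: "\<And>p. p \<in> C \<Longrightarrow> sublinear p \<and> p \<le> p0"
    and chain: "\<And>p q. p \<in> C \<Longrightarrow> q \<in> C \<Longrightarrow> p \<le> q \<or> q \<le> p"
  obtains u where "sublinear u" "\<And>p. p \<in> C \<Longrightarrow> u \<le> p"
proof -
  define u where "u x = (INF p\<in>C. p x)" for x
  have bdd: "bdd_below ((\<lambda>p. p x) ` C)" for x
  proof (intro bdd_belowI[of _ "- p0 (- x)"])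
    fix z assume "z \<in> (\<lambda>p. p x) ` C"
    then obtain p where p: "p \<in> C" "z = p x" by blast
    then have "- p (- x) \<le> z" "p (- x) \<le> p0 (- x)"
      using sub[of p] sublinear_minus by (auto simp: le_fun_def)
    then show "- p0 (- x) \<le> z" by simp
  qed
  have le: "u x \<le> p x" if "p \<in> C" for p x
    unfolding u_def using that by (intro cINF_lower[OF bdd]) auto
  have ge: "z \<le> u x" if "\<And>p. p \<in> C \<Longrightarrow> z \<le> p x" for z x
    unfolding u_def using that \<open>C \<noteq> {}\<close> by (intro cINF_greatest) auto
  have "sublinear u"
  proof (rule sublinearI)
    fix x y
    have *: "u (x + y) \<le> p x + q y" if pq: "p \<in> C" "q \<in> C" for p q
    proof -
      \<comment> \<open>Here the chain condition enters: the smaller of \<open>p\<close> and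
        \<open>q\<close> bounds both summands at once.\<close>
      obtain r where r: "r \<in> C" "r \<le> p" "r \<le> q"
        using chain[OF pq] pq by blast
      have "u (x + y) \<le> r (x + y)" using r by (intro le)
      also have "\<dots> \<le> r x + r y" using sub[OF r(1)] by (simp add: sublinear_add)
      also have "\<dots> \<le> p x + q y" using r by (intro add_mono) (auto simp: le_fun_def)
      finally show ?thesis .
    qed
    have "u (x + y) - q y \<le> u x" if "q \<in> C" for q
      by (rule ge) (use *[OF _ that] in \<open>simp add: algebra_simps\<close>)
    then have "u (x + y) - u x \<le> u y" by (intro ge) (simp add: algebra_simps)
    then show "u (x + y) \<le> u x + u y" by simp
  next
    fix c :: real and x assume c: "c > 0"
    have "u (c *\<^sub>R x) / c \<le> p x" if "p \<in> C" for p
      using le[OF that, of "c *\<^sub>R x"] sublinear_scaleR[of p c x] sub[OF that] c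
      by (simp add: field_simps)
    then have "u (c *\<^sub>R x) / c \<le> u x" by (rule ge)
    then show "u (c *\<^sub>R x) \<le> c * u x" using c by (simp add: field_simps)
  qed
  then show thesis using le by (intro that) (auto simp: le_fun_def)
qed

text \<open>
  A sublinear functional that is minimal with respect to the pointwise order is linear, since
  descending along \<open>y\<close> does not change it and hence yields \<open>m (- y) \<le> - m y\<close>.
\<close>

lemma norming_functional:
  fixes x0 :: "'a::real_normed_vector"
  obtains \<phi> :: "'a \<Rightarrow> real" where "linear \<phi>" "\<And>x. \<bar>\<phi> x\<bar> \<le> norm x" "\<phi> x0 = norm x0"
proof -
  have "sublinear (norm :: 'a \<Rightarrow> real)"
    by (intro sublinearI) (auto simp: norm_triangle_ineq)
  \<comment> \<open>Descending from the norm along \<open>x0\<close> first means that every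
    functional below \<open>p0\<close> is at most \<open>- norm x0\<close> at \<open>- x0\<close>.
    Once the minimal one is odd, its value at \<open>x0\<close> must be
    \<open>norm x0\<close>.\<close>
  then obtain p0 :: "'a \<Rightarrow> real"
    where p0: "sublinear p0" "p0 \<le> norm" "p0 (- x0) \<le> - norm x0"
    by (rule sublinear_descend)
  define A where "A = {p. sublinear p \<and> p \<le> p0}"
  \<comment> \<open>Zorn's lemma for the reversed order: a maximal element is a minimal
    functional.\<close>
  have "\<exists>m\<in>A. \<forall>a\<in>A. a \<le> m \<longrightarrow> a = m"
  proof (rule predicate_Zorn[of A "\<lambda>p q. q \<le> p", simplified])
    show "partial_order_on A (relation_of (\<lambda>p q. q \<le> p) A)"
      by (rule partial_order_on_relation_ofI) auto
  next
    fix C assume C: "C \<in> Chains (relation_of (\<lambda>p q. q \<le> p) A)"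
    show "\<exists>u\<in>A. \<forall>a\<in>C. u \<le> a"
    proof (cases "C = {}")
      case True
      then show ?thesis using p0 by (auto simp: A_def)
    next
      case False
      have CA: "C \<subseteq> A" using C by (auto simp: Chains_def relation_of_def)
      have "sublinear p \<and> p \<le> p0" if "p \<in> C" for p using that CA by (auto simp: A_def)
      moreover have "p \<le> q \<or> q \<le> p" if "p \<in> C" "q \<in> C" for p q
        using C that by (auto simp: Chains_def relation_of_def)
      ultimately obtain u where u: "sublinear u" "\<And>p. p \<in> C \<Longrightarrow> u \<le> p"
        using sublinear_Inf_chain[OF False, of p0] by metis
      have "u \<le> p0" using False u(2) CA by (force simp: A_def intro: order_trans)
      then show ?thesis using u by (auto simp: A_def)
    qed
  qed
  then obtain m where m: "sublinear m" "m \<le> p0" and min: "\<And>a. sublinear a \<Longrightarrow> a \<le> p0 \<Longrightarrow> a \<le> m \<Longrightarrow> a = m"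
    by (auto simp: A_def)
  have neg: "m (- y) = - m y" for y
  proof -
    obtain q where q: "sublinear q" "q \<le> m" "q (- y) \<le> - m y"
      by (rule sublinear_descend[OF m(1)])
    then have "q = m" using m(2) by (intro min) auto
    then show ?thesis using q(3) sublinear_minus[OF m(1), of y] by simp
  qed
  have add: "m (x + y) = m x + m y" for x y
    using sublinear_add[OF m(1), of x y] sublinear_add[OF m(1), of "- x" "- y"] neg[of "x + y"]
    by (simp add: neg)
  have scale: "m (c *\<^sub>R x) = c * m x" for c x
    using sublinear_scaleR[OF m(1), of c x] sublinear_scaleR[OF m(1), of "- c" x] neg[of "c *\<^sub>R x"]
    by (cases "c \<ge> 0") auto
  have le: "m x \<le> norm x" for x using m(2) p0(2) by (auto simp: le_fun_def intro: order_trans)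
  show thesis
  proof
    show "linear m" by (rule linearI) (auto simp: add scale)
    show "\<bar>m x\<bar> \<le> norm x" for x using le[of x] le[of "- x"] neg[of x] by simp
    show "m x0 = norm x0"
      using le[of x0] m(2) p0(3) neg[of x0] by (auto simp: le_fun_def intro: antisym order_trans dest: spec[of _ "- x0"])
  qed
qed

section \<open>Complex scalar multiplication and complex-linear functionals\<close>

lemma bounded_bilinear_scaleC: "bounded_bilinear (scaleC :: complex \<Rightarrow> 'e \<Rightarrow> 'e::complex_banach)"
proof
  fix a b :: complex and x y :: 'e and r :: real
  show "(a + b) *\<^sub>C x = a *\<^sub>C x + b *\<^sub>C x" "a *\<^sub>C (x + y) = a *\<^sub>C x + a *\<^sub>C y"
    by (rule scaleC_add_left scaleC_add_right)+
  show "(r *\<^sub>R a) *\<^sub>C x = r *\<^sub>R a *\<^sub>C x" "a *\<^sub>C (r *\<^sub>R x) = r *\<^sub>R a *\<^sub>C x"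
    unfolding scaleR_conv_of_real by (simp_all add: scaleC_of_real[symmetric] scaleC_scaleC mult.commute)
  show "\<exists>K. \<forall>a (b::'e). norm (a *\<^sub>C b) \<le> norm a * norm b * K"
    by (rule exI[of _ 1]) (simp add: norm_scaleC)
qed

interpretation scaleC: bounded_bilinear "scaleC :: complex \<Rightarrow> 'e \<Rightarrow> 'e::complex_banach"
  by (rule bounded_bilinear_scaleC)

lemma scaleC_one [simp]: "1 *\<^sub>C x = (x :: 'e::complex_banach)"
  using scaleC_of_real[of 1 x] by simp

text \<open>The usual complexification \<open>\<phi> x - \<i> * \<phi> (\<i> *\<^sub>C x)\<close> of
  a real norming functional. The crude bound by the sum of real and imaginary parts yields the
  factor 2, which is harmless for the estimates below.\<close>

lemma complex_norming_functional:
  fixes x0 :: "'e::complex_banach"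
  obtains \<Phi> :: "'e \<Rightarrow> complex"
  where "linear \<Phi>" "\<And>c x. \<Phi> (c *\<^sub>C x) = c * \<Phi> x" "\<And>x. cmod (\<Phi> x) \<le> 2 * norm x"
    "norm x0 \<le> cmod (\<Phi> x0)"
proof -
  obtain \<phi> :: "'e \<Rightarrow> real" where \<phi>: "linear \<phi>" "\<And>x. \<bar>\<phi> x\<bar> \<le> norm x" "\<phi> x0 = norm x0"
    using norming_functional[of x0] by blast
  interpret linear \<phi> by fact
  define \<Phi> where "\<Phi> x = Complex (\<phi> x) (- \<phi> (\<i> *\<^sub>C x))" for x
  show thesis
  proof
    show "linear \<Phi>"
      by (rule linearI) (simp_all add: \<Phi>_def complex_eq_iff scaleC_add_right scaleC.scaleR_right add scale)
    show "\<Phi> (c *\<^sub>C x) = c * \<Phi> x" for c x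
    proof -
      have 1: "c *\<^sub>C x = Re c *\<^sub>R x + Im c *\<^sub>R (\<i> *\<^sub>C x)"
        by (subst complex_eq) (simp add: scaleC_add_left scaleC_of_real[symmetric] scaleC_scaleC mult.commute)
      have 2: "\<i> *\<^sub>C c *\<^sub>C x = Re c *\<^sub>R (\<i> *\<^sub>C x) - Im c *\<^sub>R x"
        by (simp add: 1 scaleC_add_right scaleC.scaleR_right scaleC_scaleC scaleC.minus_left)
      show ?thesis
        by (simp only: \<Phi>_def 2) (simp add: 1 complex_eq_iff add diff scale)
    qed
    show "cmod (\<Phi> x) \<le> 2 * norm x" for x
      using cmod_le[of "\<Phi> x"] \<phi>(2)[of x] \<phi>(2)[of "\<i> *\<^sub>C x"] by (simp add: \<Phi>_def norm_scaleC)
    show "norm x0 \<le> cmod (\<Phi> x0)"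
      using complex_Re_le_cmod[of "\<Phi> x0"] \<phi>(3) by (simp add: \<Phi>_def)
  qed
qed

section \<open>Vector-valued holomorphic functions\<close>

text \<open>The mean value inequality for \<open>deriv g\<close>, with the second derivative bounded
  by Cauchy's estimate on circles of radius \<open>\<rho>\<close>; these stay inside the large ball.
  The constant depends on \<open>g\<close> only through \<open>M\<close>.\<close>

lemma holomorphic_deriv_Lipschitz:
  assumes "g holomorphic_on ball z0 (3 * \<rho>)" "\<rho> > 0"
    and M: "\<And>z. z \<in> ball z0 (3 * \<rho>) \<Longrightarrow> cmod (g z) \<le> M"
    and z: "z \<in> ball z0 \<rho>" and w: "w \<in> ball z0 \<rho>"
  shows "cmod (deriv g z - deriv g w) \<le> 2 * M / \<rho>\<^sup>2 * cmod (z - w)"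
proof (rule field_differentiable_bound[OF convex_ball _ _ z w])
  fix x assume x: "x \<in> ball z0 \<rho>"
  have "x \<in> ball z0 (3 * \<rho>)" using x \<open>\<rho> > 0\<close> by simp
  moreover have "deriv g holomorphic_on ball z0 (3 * \<rho>)"
    by (intro holomorphic_deriv assms) auto
  ultimately have "(deriv g has_field_derivative deriv (deriv g) x) (at x)"
    by (intro holomorphic_derivI) auto
  then show "(deriv g has_field_derivative (deriv ^^ 2) g x) (at x within ball z0 \<rho>)"
    by (simp add: numeral_2_eq_2 has_field_derivative_at_within)
  have sub: "cball x \<rho> \<subseteq> ball z0 (3 * \<rho>)"
  proof
    fix y assume "y \<in> cball x \<rho>"
    then show "y \<in> ball z0 (3 * \<rho>)"
      using x dist_triangle[of z0 y x] \<open>\<rho> > 0\<close> by simp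
  qed
  have "cmod ((deriv ^^ 2) g x) \<le> fact 2 * M / \<rho> ^ 2"
  proof (rule Cauchy_inequality[OF _ _ \<open>\<rho> > 0\<close>])
    show "g holomorphic_on ball x \<rho>"
      using sub ball_subset_cball by (intro holomorphic_on_subset[OF assms(1)]) blast
    show "continuous_on (cball x \<rho>) g"
      using holomorphic_on_imp_continuous_on[OF assms(1)] sub continuous_on_subset by metis
    show "cmod (g y) \<le> M" if "norm (x - y) = \<rho>" for y
      using that sub by (intro M) (auto simp: dist_norm)
  qed
  then show "cmod ((deriv ^^ 2) g x) \<le> 2 * M / \<rho>\<^sup>2" by simp
qed

lemma vholomorphic_on_imp_continuous_on:
  assumes "f vholomorphic_on S"
  shows "continuous_on S f"
  unfolding continuous_on_eq_continuous_within
proof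
  fix z assume "z \<in> S"
  then obtain D where "(f has_derivative (\<lambda>h. h *\<^sub>C D)) (at z within S)"
    using assms by (auto simp: vholomorphic_on_def)
  then show "continuous (at z within S) f" by (rule has_derivative_continuous)
qed

lemma vholomorphic_onD:
  assumes "f vholomorphic_on S" "open S" "z \<in> S"
  obtains D where "(f has_derivative (\<lambda>h. h *\<^sub>C D)) (at z)"
proof -
  obtain D where "(f has_derivative (\<lambda>h. h *\<^sub>C D)) (at z within S)"
    using bspec[OF assms(1)[unfolded vholomorphic_on_def] assms(3)] ..
  then have "(f has_derivative (\<lambda>h. h *\<^sub>C D)) (at z)"
    by (simp only: at_within_open[OF assms(3,2)])
  then show thesis by (rule that)
qed

text \<open>
  Composing with norming functionals reduces the claim to the Cauchy estimate for scalar
  functions, whose constants do not depend on the functional.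
\<close>

lemma vholomorphic_deriv_continuous:
  fixes f :: "complex \<Rightarrow> 'e::complex_banach"
  assumes "open S" and D: "\<And>z. z \<in> S \<Longrightarrow> (f has_derivative (\<lambda>h. h *\<^sub>C D z)) (at z)"
  shows "continuous_on S D"
proof -
  have "isCont D z0" if z0: "z0 \<in> S" for z0
  proof -
    obtain e where e: "e > 0" "cball z0 e \<subseteq> S" using open_contains_cball_eq[OF assms(1)] z0 by metis
    define \<rho> where "\<rho> = e / 3"
    have \<rho>: "\<rho> > 0" "ball z0 (3 * \<rho>) \<subseteq> cball z0 e" using e by (auto simp: \<rho>_def)
    have "continuous_on (cball z0 e) f"
      using e(2) has_derivative_continuous[OF D] by (intro continuous_at_imp_continuous_on) auto
    then have "bounded (f ` cball z0 e)"
      by (intro compact_imp_bounded compact_continuous_image) auto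
    then obtain M where M: "M > 0" "\<And>z. z \<in> cball z0 e \<Longrightarrow> norm (f z) \<le> M"
      by (auto simp: bounded_pos)
    \<comment> \<open>The Lipschitz constant for scalar functions bounded by \<open>2 * M\<close>,
      which is the bound for \<open>\<Phi> \<circ> f\<close> when \<open>\<Phi>\<close> at most
      doubles norms.\<close>
    define C where "C = 2 * (2 * M) / \<rho>\<^sup>2"
    have lip: "norm (D z - D w) \<le> C * cmod (z - w)"
      if z: "z \<in> ball z0 \<rho>" and w: "w \<in> ball z0 \<rho>" for z w
    proof -
      have "ball z0 \<rho> \<subseteq> ball z0 (3 * \<rho>)" using \<rho>(1) by (intro subset_ball) simp
      then have zw: "z \<in> S" "w \<in> S" using z w \<rho>(2) e(2) by blast+
      \<comment> \<open>The functional is adapted to the pair \<open>z\<close>, \<open>w\<close>,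
        whereas \<open>C\<close> was fixed beforehand.\<close>
      obtain \<Phi> :: "'e \<Rightarrow> complex"
        where \<Phi>: "linear \<Phi>" "\<And>c x. \<Phi> (c *\<^sub>C x) = c * \<Phi> x" "\<And>x. cmod (\<Phi> x) \<le> 2 * norm x"
          "norm (D z - D w) \<le> cmod (\<Phi> (D z - D w))"
        using complex_norming_functional[of "D z - D w"] by blast
      have bl: "bounded_linear \<Phi>"
        using \<Phi>(3) by (intro bounded_linear_intro[of _ 2])
          (auto simp: mult.commute linear_add[OF \<Phi>(1)] linear_cmul[OF \<Phi>(1)])
      have der: "((\<Phi> \<circ> f) has_field_derivative \<Phi> (D x)) (at x)" if "x \<in> S" for x
        using bounded_linear.has_derivative[OF bl D[OF that]]
        by (simp add: has_field_derivative_def \<Phi>(2) o_def mult_commute_abs)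
      have "cmod (deriv (\<Phi> \<circ> f) z - deriv (\<Phi> \<circ> f) w) \<le> C * cmod (z - w)"
        unfolding C_def
      proof (rule holomorphic_deriv_Lipschitz[OF _ \<rho>(1) _ z w])
        show "\<Phi> \<circ> f holomorphic_on ball z0 (3 * \<rho>)"
          unfolding holomorphic_on_def field_differentiable_def
        proof (intro ballI exI)
          fix x assume "x \<in> ball z0 (3 * \<rho>)"
          then have "x \<in> S" using e(2) \<rho>(2) by blast
          then show "(\<Phi> \<circ> f has_field_derivative \<Phi> (D x)) (at x within ball z0 (3 * \<rho>))"
            by (rule has_field_derivative_at_within[OF der])
        qed
        show "cmod ((\<Phi> \<circ> f) x) \<le> 2 * M" if "x \<in> ball z0 (3 * \<rho>)" for x
          using order_trans[OF \<Phi>(3)[of "f x"]] M(2)[of x] \<rho>(2) that by auto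
      qed
      moreover have "deriv (\<Phi> \<circ> f) z = \<Phi> (D z)" "deriv (\<Phi> \<circ> f) w = \<Phi> (D w)"
        using zw by (auto intro: DERIV_imp_deriv[OF der])
      ultimately show ?thesis using \<Phi>(4) linear_diff[OF \<Phi>(1), of "D z" "D w"] by simp
    qed
    have "\<forall>\<^sub>F z in at z0. norm (D z - D z0) \<le> C * cmod (z - z0)"
      by (rule eventually_mono[OF eventually_at_ball[OF \<rho>(1), of z0 UNIV]])
        (use lip[of _ z0] \<rho>(1) in simp)
    moreover have "((\<lambda>z. C * cmod (z - z0)) \<longlongrightarrow> 0) (at z0)"
      by (auto intro!: tendsto_eq_intros)
    ultimately have "((\<lambda>z. D z - D z0) \<longlongrightarrow> 0) (at z0)"
      by (rule Lim_null_comparison)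
    then show ?thesis by (simp add: isCont_def LIM_zero_iff)
  qed
  then show ?thesis by (intro continuous_at_imp_continuous_on) auto
qed

text \<open>Differentiation under the integral sign. The Leibniz rule asks for a jointly continuous
  derivative of the integrand, which is why continuity of the derivative of \<open>f\<close> was
  established first.\<close>

lemma vholomorphic_integral:
  fixes f :: "complex \<Rightarrow> 'e::complex_banach" and a q :: "real \<Rightarrow> complex"
  assumes f: "f vholomorphic_on S" and "open S" "open T"
    and a: "continuous_on {lo..hi} a" and q: "continuous_on {lo..hi} q"
    and maps: "\<And>s z. s \<in> {lo..hi} \<Longrightarrow> z \<in> T \<Longrightarrow> q s * z \<in> S"
  shows "(\<lambda>z. integral {lo..hi} (\<lambda>s. a s *\<^sub>C f (q s * z))) vholomorphic_on T"
  unfolding vholomorphic_on_def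
proof
  fix z0 assume z0: "z0 \<in> T"
  define F where "F = (\<lambda>z. integral {lo..hi} (\<lambda>s. a s *\<^sub>C f (q s * z)))"
  \<comment> \<open>The Leibniz rule works on a convex set, hence on a ball; since the ball and
    \<open>T\<close> are open, the derivative carries over to \<open>T\<close>.\<close>
  obtain e where e: "e > 0" "ball z0 e \<subseteq> T" using openE[OF \<open>open T\<close> z0] by metis
  define U where "U = ball z0 e"
  have U: "z0 \<in> U" "U \<subseteq> T" "convex U" "open U" using e by (auto simp: U_def)
  define D where "D z = (SOME D. (f has_derivative (\<lambda>h. h *\<^sub>C D)) (at z))" for z
  have D: "(f has_derivative (\<lambda>h. h *\<^sub>C D z)) (at z)" if z: "z \<in> S" for z
  proof -
    obtain D' where "(f has_derivative (\<lambda>h. h *\<^sub>C D')) (at z)"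
      by (rule vholomorphic_onD[OF f \<open>open S\<close> z])
    then show ?thesis unfolding D_def by (rule someI)
  qed
  have contD: "continuous_on S D" by (rule vholomorphic_deriv_continuous[OF \<open>open S\<close> D])
  have contf: "continuous_on S f" by (rule vholomorphic_on_imp_continuous_on[OF f])
  define G where "G z s = (a s * q s) *\<^sub>C D (q s * z)" for z s
  note [continuous_intros] = continuous_on_compose2[OF a] continuous_on_compose2[OF q]
    continuous_on_compose2[OF contf] continuous_on_compose2[OF contD] scaleC.continuous_on
  have "((\<lambda>z. integral (cbox lo hi) (\<lambda>s. a s *\<^sub>C f (q s * z))) has_derivative
      blinfun_apply (integral (cbox lo hi) (\<lambda>s. scaleC.prod_left (G z0 s)))) (at z0 within U)"
  proof (rule leibniz_rule[OF _ _ _ U(1,3)])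
    fix z s assume z: "z \<in> U" and s: "s \<in> cbox lo hi"
    have "((\<lambda>z. f (q s * z)) has_derivative (\<lambda>h. (q s * h) *\<^sub>C D (q s * z))) (at z)"
      using z s U(2) maps by (intro has_derivative_compose[OF _ D]) (auto intro!: derivative_eq_intros)
    then have "((\<lambda>z. a s *\<^sub>C f (q s * z)) has_derivative (\<lambda>h. a s *\<^sub>C (q s * h) *\<^sub>C D (q s * z))) (at z)"
      by (rule bounded_linear.has_derivative[OF scaleC.bounded_linear_right])
    then have "((\<lambda>z. a s *\<^sub>C f (q s * z)) has_derivative blinfun_apply (scaleC.prod_left (G z s))) (at z)"
      by (simp add: scaleC.prod_left.rep_eq G_def scaleC_scaleC mult_ac)
    then show "((\<lambda>z. a s *\<^sub>C f (q s * z)) has_derivative blinfun_apply (scaleC.prod_left (G z s))) (at z within U)"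
      by (rule has_derivative_at_withinI)
  next
    fix z assume z: "z \<in> U"
    show "(\<lambda>s. a s *\<^sub>C f (q s * z)) integrable_on cbox lo hi"
      using z U(2) maps by (intro integrable_continuous) (auto intro!: continuous_intros)
  next
    \<comment> \<open>Continuity of the vector-valued derivative \<open>G\<close> passes to the
      linear maps \<open>\<lambda>h. h *\<^sub>C G z s\<close>, since \<open>prod_left\<close> is
      bounded linear.\<close>
    have "continuous_on (U \<times> cbox lo hi) (\<lambda>x. G (fst x) (snd x))"
      using U(2) maps unfolding G_def by (auto intro!: continuous_intros)
    then show "continuous_on (U \<times> cbox lo hi) (\<lambda>(z, s). scaleC.prod_left (G z s))"
      unfolding split_beta by (rule bounded_linear.continuous_on[OF scaleC.bounded_linear_prod_left])
  qed
  also have "integral (cbox lo hi) (\<lambda>s. scaleC.prod_left (G z0 s)) = scaleC.prod_left (integral (cbox lo hi) (G z0))"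
  proof -
    have "continuous_on (cbox lo hi) (G z0)"
      using U maps unfolding G_def by (auto intro!: continuous_intros)
    from integral_linear[OF integrable_continuous[OF this] scaleC.bounded_linear_prod_left]
    show ?thesis by (simp add: o_def)
  qed
  finally have "(F has_derivative (\<lambda>h. h *\<^sub>C integral {lo..hi} (G z0))) (at z0 within U)"
    by (simp add: scaleC.prod_left.rep_eq F_def)
  then have "(F has_derivative (\<lambda>h. h *\<^sub>C integral {lo..hi} (G z0))) (at z0 within T)"
    by (simp only: at_within_open[OF U(1,4)] at_within_open[OF z0 \<open>open T\<close>])
  then have "\<exists>D. (F has_derivative (\<lambda>h. h *\<^sub>C D)) (at z0 within T)"
    by (rule exI[where x = "integral {lo..hi} (G z0)"])
  then show "\<exists>D. ((\<lambda>z. integral {lo..hi} (\<lambda>s. a s *\<^sub>C f (q s * z))) has_derivative (\<lambda>h. h *\<^sub>C D)) (at z0 within T)"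
    by (simp only: F_def)
qed

section \<open>Integral operators on functions of exponential growth\<close>

lemma sector_iff: "z \<in> sector d \<alpha> \<longleftrightarrow> (\<exists>\<rho> \<phi>. z = rcis \<rho> \<phi> \<and> 0 < \<rho> \<and> \<bar>\<phi> - d\<bar> < \<alpha> / 2)"
proof -
  have "\<phi> \<in> {d - \<alpha> / 2<..<d + \<alpha> / 2} \<longleftrightarrow> \<bar>\<phi> - d\<bar> < \<alpha> / 2" for \<phi>
    unfolding greaterThanLessThan_iff by linarith
  then show ?thesis unfolding sector_def by simp
qed

text \<open>Arguments add, and \<open>\<alpha>\<close> is the full opening, hence the factor 2. No
  branch problem arises because a sector admits every polar representation of its points.\<close>

lemma sector_mult:
  assumes z: "z \<in> sector d \<alpha>" and \<zeta>: "\<zeta> \<noteq> 0" "\<bar>Arg \<zeta>\<bar> \<le> \<delta>"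
  shows "\<zeta> * z \<in> sector d (\<alpha> + 2 * \<delta>)"
proof -
  obtain \<rho> \<phi> where z': "z = rcis \<rho> \<phi>" "0 < \<rho>" "\<bar>\<phi> - d\<bar> < \<alpha> / 2" using z by (auto simp: sector_iff)
  have "\<zeta> * z = rcis (cmod \<zeta> * \<rho>) (Arg \<zeta> + \<phi>)"
    using rcis_mult[of "cmod \<zeta>" "Arg \<zeta>" \<rho> \<phi>] z'(1) by (simp add: rcis_cmod_Arg)
  moreover have "0 < cmod \<zeta> * \<rho>" using \<zeta> z' by simp
  moreover have "\<bar>Arg \<zeta> + \<phi> - d\<bar> < (\<alpha> + 2 * \<delta>) / 2" using z'(3) \<zeta>(2) by argo
  ultimately show ?thesis unfolding sector_iff by blast
qed

lemma sector_mono: "\<alpha> \<le> \<alpha>' \<Longrightarrow> sector d \<alpha> \<subseteq> sector d \<alpha>'"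
  by (force simp: sector_iff)

lemma disc_sector_mono: "\<alpha> \<le> \<alpha>' \<Longrightarrow> r \<le> r' \<Longrightarrow> disc_sector d \<alpha> r \<subseteq> disc_sector d \<alpha>' r'"
  using sector_mono[of \<alpha> \<alpha>' d] by (auto simp: disc_sector_def)

lemma small_Arg_near_one:
  assumes "\<delta> > 0"
  obtains c where "0 < c" "c < 1" "\<And>\<zeta>. cmod (\<zeta> - 1) \<le> c \<Longrightarrow> \<zeta> \<noteq> 0 \<and> \<bar>Arg \<zeta>\<bar> \<le> \<delta>"
proof -
  have "isCont Arg 1" by (rule continuous_at_Arg) simp
  then obtain e where e: "e > 0" "\<And>\<zeta>. cmod (\<zeta> - 1) < e \<Longrightarrow> \<bar>Arg \<zeta>\<bar> < \<delta>"
    using assms unfolding continuous_at_eps_delta by (auto simp: dist_norm)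
  show thesis
  proof
    show "0 < min (e/2) (1/2)" "min (e/2) (1/2) < 1" using e(1) by auto
    fix \<zeta> :: complex assume \<zeta>: "cmod (\<zeta> - 1) \<le> min (e/2) (1/2)"
    then have "\<zeta> \<noteq> 0" by auto
    moreover have "\<bar>Arg \<zeta>\<bar> < \<delta>" using \<zeta> e by (intro e(2)) linarith
    ultimately show "\<zeta> \<noteq> 0 \<and> \<bar>Arg \<zeta>\<bar> \<le> \<delta>" by simp
  qed
qed

text \<open>A point \<open>w\<close> near \<open>z\<close> is \<open>(w / z) * z\<close> with
  \<open>w / z\<close> near 1, so it differs from \<open>z\<close> by a small rotation and
  scaling.\<close>

lemma open_sector: "open (sector d \<alpha>)"
  unfolding open_contains_ball
proof
  fix z assume "z \<in> sector d \<alpha>"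
  then obtain \<rho> \<phi> where z: "z = rcis \<rho> \<phi>" "0 < \<rho>" "\<bar>\<phi> - d\<bar> < \<alpha> / 2" by (auto simp: sector_iff)
  \<comment> \<open>Half of the angular slack: \<open>z\<close> still lies in the sector of opening
    \<open>\<alpha> - 2 * \<delta>\<close>, and multiplication by \<open>w / z\<close> widens it
    back to \<open>\<alpha>\<close>.\<close>
  define \<delta> where "\<delta> = (\<alpha> / 2 - \<bar>\<phi> - d\<bar>) / 2"
  have "\<delta> > 0" using z by (simp add: \<delta>_def)
  then obtain c where c: "0 < c" "\<And>\<zeta>. cmod (\<zeta> - 1) \<le> c \<Longrightarrow> \<zeta> \<noteq> 0 \<and> \<bar>Arg \<zeta>\<bar> \<le> \<delta>"
    by (metis small_Arg_near_one)
  have z0: "z \<noteq> 0" using z by simp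
  have zs: "z \<in> sector d (\<alpha> - 2 * \<delta>)"
    unfolding sector_iff using z by (intro exI[of _ \<rho>] exI[of _ \<phi>]) (auto simp: \<delta>_def field_simps)
  have "ball z (c * cmod z) \<subseteq> sector d \<alpha>"
  proof
    fix w assume "w \<in> ball z (c * cmod z)"
    then have "cmod (w / z - 1) * cmod z \<le> c * cmod z"
      using z0 by (simp add: dist_norm left_diff_distrib norm_minus_commute[of z w] flip: norm_mult)
    then have "cmod (w / z - 1) \<le> c" using z0 by simp
    then have "(w / z) * z \<in> sector d (\<alpha> - 2 * \<delta> + 2 * \<delta>)"
      using c(2)[of "w / z"] by (intro sector_mult[OF zs]) blast+
    then show "w \<in> sector d \<alpha>" using z0 by simp
  qed
  then show "\<exists>e>0. ball z e \<subseteq> sector d \<alpha>" using c(1) z0 by (intro exI[of _ "c * cmod z"]) simp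
qed

lemma open_disc_sector: "open (disc_sector d \<alpha> r)"
  by (simp add: disc_sector_def open_Un open_sector)

section \<open>Power series and kernel operators\<close>

lemma power_series_coeff_bound:
  fixes v :: "nat \<Rightarrow> 'e::complex_banach"
  assumes "\<epsilon> > 0" and sums: "\<And>t. t \<in> ball 0 \<epsilon> \<Longrightarrow> (\<lambda>n. t ^ n *\<^sub>C v n) sums f t"
  obtains M \<tau> where "M > 0" "\<tau> > 0" "\<tau> < \<epsilon>" "\<And>n. \<tau> ^ n * norm (v n) \<le> M"
proof -
  define \<tau> where "\<tau> = \<epsilon> / 2"
  have "(\<lambda>n. complex_of_real \<tau> ^ n *\<^sub>C v n) sums f (of_real \<tau>)"
    using \<open>\<epsilon> > 0\<close> by (intro sums) (simp add: \<tau>_def)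
  then have "(\<lambda>n. complex_of_real \<tau> ^ n *\<^sub>C v n) \<longlonglongrightarrow> 0"
    by (rule summable_LIMSEQ_zero[OF sums_summable])
  then have "Bseq (\<lambda>n. complex_of_real \<tau> ^ n *\<^sub>C v n)"
    by (rule convergent_imp_Bseq[OF convergentI])
  then obtain M where M: "M > 0" "\<And>n. norm (complex_of_real \<tau> ^ n *\<^sub>C v n) \<le> M"
    by (auto simp: Bseq_def)
  have "\<tau> > 0" "\<tau> < \<epsilon>" using \<open>\<epsilon> > 0\<close> by (auto simp: \<tau>_def)
  then show thesis using M by (intro that[of M \<tau>]) (auto simp: norm_scaleC norm_power)
qed

text \<open>The new function is \<open>F t\<close>, the integral of
  \<open>a s *\<^sub>C f (q s * t)\<close>. Growth of order \<open>k\<close> survives because a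
  bound \<open>Q\<close> on \<open>q\<close> only multiplies \<open>B\<close> by
  \<open>Q powr k\<close>; the coefficients come from termwise integration. The intermediate
  disc-sector with \<open>\<beta>\<close> and \<open>\<rho>\<close> is there because
  \<open>f\<close> has a uniform bound only on strictly smaller disc-sectors.\<close>

lemma fps_exp_growth_kernel:
  fixes v :: "nat \<Rightarrow> 'e::complex_banach" and a q :: "real \<Rightarrow> complex"
  assumes growth: "fps_exp_growth k d \<alpha> r (Abs_fps v)" and "k > 0"
    and \<beta>: "0 < \<beta>" "\<beta> < \<alpha>" and \<rho>: "0 < \<rho>" "\<rho> < r" and "lo \<le> hi"
    and a: "continuous_on {lo..hi} a" and q: "continuous_on {lo..hi} q"
    and maps: "\<And>s t. s \<in> {lo..hi} \<Longrightarrow> t \<in> disc_sector d \<alpha>' r' \<Longrightarrow> q s * t \<in> disc_sector d \<beta> \<rho>"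
    and c: "\<And>n. ((\<lambda>s. a s * q s ^ n) has_integral c n) {lo..hi}"
  shows "fps_exp_growth k d \<alpha>' r' (Abs_fps (\<lambda>n. c n *\<^sub>C v n))"
proof -
  obtain f \<epsilon> where f: "f \<in> exp_growth_holomorphic k d \<alpha> r" and "\<epsilon> > 0"
    and sums: "\<And>t. t \<in> ball 0 \<epsilon> \<Longrightarrow> (\<lambda>n. t ^ n *\<^sub>C v n) sums f t"
    using growth by (auto simp: fps_exp_growth_def)
  have holf: "f vholomorphic_on disc_sector d \<alpha> r"
    using f by (simp add: exp_growth_holomorphic_def)
  obtain A B where AB: "A > 0" "B > 0" "\<And>t. t \<in> disc_sector d \<beta> \<rho> \<Longrightarrow> norm (f t) < A * exp (B * cmod t powr k)"
  proof -
    have "\<exists>A>0. \<exists>B>0. \<forall>t\<in>disc_sector d \<beta> \<rho>. norm (f t) < A * exp (B * cmod t powr k)"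
      using f \<beta> \<rho> by (simp add: exp_growth_holomorphic_def)
    then show thesis using that by blast
  qed
  have sub: "disc_sector d \<beta> \<rho> \<subseteq> disc_sector d \<alpha> r"
    using \<beta> \<rho> by (intro disc_sector_mono) auto
  have "bounded (a ` {lo..hi})" "bounded (q ` {lo..hi})"
    by (intro compact_imp_bounded compact_continuous_image a q compact_Icc)+
  then obtain Ma Q where Ma: "Ma > 0" "\<And>s. s \<in> {lo..hi} \<Longrightarrow> cmod (a s) \<le> Ma"
    and Q: "Q > 0" "\<And>s. s \<in> {lo..hi} \<Longrightarrow> cmod (q s) \<le> Q"
    by (auto simp: bounded_pos)
  define F where "F t = integral {lo..hi} (\<lambda>s. a s *\<^sub>C f (q s * t))" for t
  have "F vholomorphic_on disc_sector d \<alpha>' r'"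
    unfolding F_def
    by (rule vholomorphic_integral[OF holf open_disc_sector open_disc_sector a q])
      (use maps sub in blast)
  moreover have "\<exists>A>0. \<exists>B>0. \<forall>t\<in>disc_sector d \<alpha>'' r''. norm (F t) < A * exp (B * cmod t powr k)"
    if \<alpha>r: "\<alpha>'' \<in> {0<..<\<alpha>'}" "r'' \<in> {0<..<r'}" for \<alpha>'' r''
  proof -
    \<comment> \<open>The summand 1 makes the inequality strict and the constant positive, also when
      \<open>lo = hi\<close>.\<close>
    have "norm (F t) < Ma * A * (hi - lo + 1) * exp (B * Q powr k * cmod t powr k)"
      if t'': "t \<in> disc_sector d \<alpha>'' r''" for t
    proof -
      have t: "t \<in> disc_sector d \<alpha>' r'"
        using t'' \<alpha>r disc_sector_mono[of \<alpha>'' \<alpha>' r'' r' d] by auto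
      define E where "E = exp (B * Q powr k * cmod t powr k)"
      have "norm (F t) \<le> Ma * (A * E) * (hi - lo)"
        unfolding F_def
      proof (rule integral_bound[OF \<open>lo \<le> hi\<close>])
        have "continuous_on {lo..hi} (\<lambda>s. f (q s * t))"
          by (rule continuous_on_compose2[OF vholomorphic_on_imp_continuous_on[OF holf]])
            (use q maps[OF _ t] sub in \<open>auto intro!: continuous_intros\<close>)
        then show "continuous_on {lo..hi} (\<lambda>s. a s *\<^sub>C f (q s * t))"
          by (intro scaleC.continuous_on a)
      next
        fix s assume s: "s \<in> {lo..hi}"
        have "cmod (q s * t) powr k \<le> (Q * cmod t) powr k"
          using Q(2)[OF s] \<open>k > 0\<close> by (intro powr_mono2) (auto simp: norm_mult mult_right_mono)
        also have "\<dots> = Q powr k * cmod t powr k"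
          using Q(1) by (simp add: powr_mult)
        finally have "B * cmod (q s * t) powr k \<le> B * Q powr k * cmod t powr k"
          using AB(2) by (simp add: mult.assoc)
        then have "A * exp (B * cmod (q s * t) powr k) \<le> A * E"
          using AB(1) by (simp add: E_def)
        then have "norm (f (q s * t)) \<le> A * E"
          using AB(3)[OF maps[OF s t]] by linarith
        then show "norm (a s *\<^sub>C f (q s * t)) \<le> Ma * (A * E)"
          unfolding norm_scaleC using Ma s by (intro mult_mono) auto
      qed
      also have "\<dots> < Ma * A * (hi - lo + 1) * E"
        using Ma AB by (simp add: algebra_simps E_def)
      finally show ?thesis
        by (simp add: E_def)
    qed
    moreover have "Ma * A * (hi - lo + 1) > 0" using Ma AB \<open>lo \<le> hi\<close> by (simp add: add_nonneg_pos)
    moreover have "B * Q powr k > 0" using AB Q by (intro mult_pos_pos) auto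
    ultimately show ?thesis by blast
  qed
  ultimately have "F \<in> exp_growth_holomorphic k d \<alpha>' r'"
    by (simp add: exp_growth_holomorphic_def)
  moreover have "\<exists>\<epsilon>'>0. \<forall>t\<in>ball 0 \<epsilon>'. (\<lambda>n. t ^ n *\<^sub>C c n *\<^sub>C v n) sums F t"
  proof -
    obtain M \<tau> where M: "M > 0" "\<tau> > 0" "\<tau> < \<epsilon>" "\<And>n. \<tau> ^ n * norm (v n) \<le> M"
      using power_series_coeff_bound[OF \<open>\<epsilon> > 0\<close> sums] by blast
    \<comment> \<open>The radius forces \<open>cmod (q s * t) \<le> \<tau> / 2\<close> for all
      \<open>s\<close>, so the terms are dominated by a geometric series uniformly in
      \<open>s\<close>, and sum and integral may be exchanged.\<close>
    have "(\<lambda>n. t ^ n *\<^sub>C c n *\<^sub>C v n) sums F t" if t: "t \<in> ball 0 (\<tau> / (2 * Q))" for t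
    proof -
      define g where "g n s = (a s * q s ^ n) *\<^sub>C t ^ n *\<^sub>C v n" for n s
      have qt: "cmod (q s * t) \<le> \<tau> / 2" if s: "s \<in> {lo..hi}" for s
      proof -
        have "cmod (q s * t) \<le> Q * (\<tau> / (2 * Q))"
          unfolding norm_mult using Q(2)[OF s] Q(1) t by (intro mult_mono) auto
        then show ?thesis using Q(1) by simp
      qed
      have g_eq: "g n s = a s *\<^sub>C (q s * t) ^ n *\<^sub>C v n" for n s
        by (simp add: g_def scaleC_scaleC power_mult_distrib mult_ac)
      have "norm (g n s) \<le> Ma * M * (1/2) ^ n" if s: "s \<in> {lo..hi}" for n s
      proof -
        have "norm ((q s * t) ^ n *\<^sub>C v n) \<le> (\<tau> / 2) ^ n * norm (v n)"
          unfolding norm_scaleC norm_power using qt[OF s] by (intro mult_right_mono power_mono) auto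
        also have "\<dots> \<le> M * (1/2) ^ n" using M(4)[of n] by (simp add: power_divide field_simps)
        finally show ?thesis
          unfolding g_eq norm_scaleC[of "a s"] using Ma(2)[OF s] Ma(1) by (simp add: mult.assoc mult_mono)
      qed
      moreover have "summable (\<lambda>n. Ma * M * (1/2) ^ n :: real)"
        by (intro summable_mult summable_geometric) simp
      ultimately have "uniform_limit {lo..hi} (\<lambda>N s. \<Sum>n<N. g n s) (\<lambda>s. \<Sum>n. g n s) sequentially"
        by (rule Weierstrass_m_test)
      also have "?this \<longleftrightarrow> uniform_limit {lo..hi} (\<lambda>N s. \<Sum>n<N. g n s) (\<lambda>s. a s *\<^sub>C f (q s * t)) sequentially"
      proof (intro uniform_limit_cong' refl)
        fix s assume s: "s \<in> {lo..hi}"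
        have "(\<lambda>n. (q s * t) ^ n *\<^sub>C v n) sums f (q s * t)"
          using qt[OF s] M by (intro sums) auto
        then have "(\<lambda>n. g n s) sums (a s *\<^sub>C f (q s * t))"
          unfolding g_eq by (rule bounded_linear.sums[OF scaleC.bounded_linear_right])
        then show "(\<Sum>n. g n s) = a s *\<^sub>C f (q s * t)" by (rule sums_unique[symmetric])
      qed
      finally have ul: "uniform_limit {lo..hi} (\<lambda>N s. \<Sum>n<N. g n s) (\<lambda>s. a s *\<^sub>C f (q s * t)) sequentially" .
      have int_g: "((\<lambda>s. \<Sum>n<N. g n s) has_integral (\<Sum>n<N. c n *\<^sub>C t ^ n *\<^sub>C v n)) {lo..hi}" for N
        using has_integral_linear[OF c scaleC.bounded_linear_left]
        by (intro has_integral_sum) (auto simp: g_def o_def)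
      have cont: "continuous_on {lo..hi} (\<lambda>s. \<Sum>n<N. g n s)" for N
        unfolding g_def by (intro continuous_intros scaleC.continuous_on a q)
      show ?thesis
      proof (rule uniform_limit_integral[OF ul cont sequentially_bot])
        fix I J
        assume I: "\<And>N. ((\<lambda>s. \<Sum>n<N. g n s) has_integral I N) {lo..hi}"
          and J: "((\<lambda>s. a s *\<^sub>C f (q s * t)) has_integral J) {lo..hi}"
          and IJ: "(I \<longlongrightarrow> J) sequentially"
        have "I = (\<lambda>N. \<Sum>n<N. c n *\<^sub>C t ^ n *\<^sub>C v n)"
          by (rule ext) (rule has_integral_unique[OF I int_g])
        moreover have "J = F t" using J by (simp add: F_def integral_unique)
        ultimately show ?thesis
          using IJ by (simp add: sums_def scaleC_scaleC mult.commute)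
      qed
    qed
    then show ?thesis using M Q by (intro exI[of _ "\<tau> / (2 * Q)"]) auto
  qed
  ultimately show ?thesis unfolding fps_exp_growth_def by auto
qed

section \<open>Multiplication and division of coefficients by a linear factor\<close>

text \<open>Here \<open>v\<close> stands for coefficients after the Borel transform. Leaving the
  disc-sector existential lets each operator shrink it.\<close>

definition dir_growth :: "real \<Rightarrow> real \<Rightarrow> (nat \<Rightarrow> 'e::complex_banach) \<Rightarrow> bool"
  where "dir_growth k d v \<longleftrightarrow> (\<exists>\<alpha>>0. \<exists>r>0. fps_exp_growth k d \<alpha> r (Abs_fps v))"

lemma dir_growthI: "fps_exp_growth k d \<alpha> r (Abs_fps v) \<Longrightarrow> \<alpha> > 0 \<Longrightarrow> r > 0 \<Longrightarrow> dir_growth k d v"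
  by (auto simp: dir_growth_def)

text \<open>Disc-sectors are star-shaped about 0, so multiplication by \<open>q s\<close> in the
  unit interval maps each of them into itself.\<close>

lemma dir_growth_kernel_unit_interval:
  fixes v :: "nat \<Rightarrow> 'e::complex_banach" and a :: "real \<Rightarrow> complex" and q :: "real \<Rightarrow> real"
  assumes v: "dir_growth k d v" and "k > 0" and "lo \<le> hi"
    and a: "continuous_on {lo..hi} a" and q: "continuous_on {lo..hi} q"
    and q01: "\<And>s. s \<in> {lo..hi} \<Longrightarrow> 0 \<le> q s \<and> q s \<le> 1"
    and c: "\<And>n. ((\<lambda>s. a s * of_real (q s) ^ n) has_integral c n) {lo..hi}"
  shows "dir_growth k d (\<lambda>n. c n *\<^sub>C v n)"
proof -
  obtain \<alpha> r where \<alpha>r: "\<alpha> > 0" "r > 0" and g: "fps_exp_growth k d \<alpha> r (Abs_fps v)"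
    using v by (auto simp: dir_growth_def)
  have "fps_exp_growth k d (\<alpha> / 2) (r / 2) (Abs_fps (\<lambda>n. c n *\<^sub>C v n))"
  proof (rule fps_exp_growth_kernel[OF g \<open>k > 0\<close> _ _ _ _ \<open>lo \<le> hi\<close> a _ _ c])
    show "continuous_on {lo..hi} (\<lambda>s. complex_of_real (q s))"
      by (intro continuous_intros q)
    fix s t assume s: "s \<in> {lo..hi}" and t: "t \<in> disc_sector d (\<alpha> / 2) (r / 2)"
    show "of_real (q s) * t \<in> disc_sector d (\<alpha> / 2) (r / 2)"
    \<comment> \<open>The factor 0 moves a point of the sector to the origin, which only the disc
      contains; a positive factor has argument 0.\<close>
    proof (cases "q s = 0 \<or> t \<in> ball 0 (r / 2)")
      case True
      have "cmod (of_real (q s) * t) < r / 2"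
      proof (cases "q s = 0")
        case False
        then have "cmod t < r / 2" using True by simp
        moreover have "cmod (of_real (q s) * t) \<le> 1 * cmod t"
          unfolding norm_mult using q01[OF s] by (intro mult_right_mono) auto
        ultimately show ?thesis by simp
      qed (use \<alpha>r in simp)
      then show ?thesis by (simp add: disc_sector_def)
    next
      case False
      then have "t \<in> sector d (\<alpha> / 2)" "q s > 0" using t q01[OF s] by (auto simp: disc_sector_def)
      then have "of_real (q s) * t \<in> sector d (\<alpha> / 2 + 2 * 0)"
        by (intro sector_mult) (auto simp: Arg_of_real)
      then show ?thesis by (simp add: disc_sector_def)
    qed
  qed (use \<alpha>r in auto)
  then show ?thesis using \<alpha>r by (auto intro: dir_growthI)
qed

text \<open>The degenerate kernel with \<open>q = 1\<close> and constant \<open>a\<close> on the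
  unit interval.\<close>

lemma dir_growth_scaleC:
  assumes "dir_growth k d v" and "k > 0"
  shows "dir_growth k d (\<lambda>n. c *\<^sub>C v n)"
proof (rule dir_growth_kernel_unit_interval[OF assms, where lo = 0 and hi = 1 and a = "\<lambda>_. c" and q = "\<lambda>_. 1"])
  show "((\<lambda>s. c * of_real 1 ^ n) has_integral c) {0..1::real}" for n
    using has_integral_const_real[of c 0 1] by simp
qed auto

text \<open>The kernel \<open>s powr (- \<mu> - 1)\<close> on \<open>[0, 1]\<close> solves \<open>t g' - \<mu> g = f\<close>.\<close>

lemma dir_growth_divide_left_half_plane:
  assumes v: "dir_growth k d v" and k: "k > 0" and \<mu>: "Re \<mu> < -1"
  shows "dir_growth k d (\<lambda>n. inverse (of_nat n - \<mu>) *\<^sub>C v n)"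
proof (rule dir_growth_kernel_unit_interval[OF v k, where lo = 0 and hi = 1
      and a = "\<lambda>s. of_real s powr (- \<mu> - 1)" and q = "\<lambda>s. s"])
  \<comment> \<open>The hypothesis on \<open>\<mu>\<close> makes the real part of the exponent
    positive, so the kernel is continuous up to 0.\<close>
  show "continuous_on {0..1} (\<lambda>s. complex_of_real s powr (- \<mu> - 1))"
    using \<mu> by (intro continuous_on_powr_complex continuous_intros) auto
  fix n
  define \<nu> where "\<nu> = of_nat n - \<mu>"
  have \<nu>: "Re \<nu> > 0" "\<nu> \<noteq> 0" using \<mu> by (auto simp: \<nu>_def complex_eq_iff)
  have "((\<lambda>s. of_real s powr (- \<mu> - 1) * of_real s ^ n) has_integral
      (of_real 1 powr \<nu> / \<nu> - of_real 0 powr \<nu> / \<nu>)) {0..1::real}"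
  \<comment> \<open>The primitive is differentiated only inside the interval, because the complex
    power has its branch point at 0.\<close>
  proof (rule fundamental_theorem_of_calculus_interior)
    show "continuous_on {0..1} (\<lambda>s. complex_of_real s powr \<nu> / \<nu>)"
      using \<nu> by (intro continuous_on_powr_complex continuous_intros) auto
    fix s :: real assume s: "s \<in> {0<..<1}"
    have "((\<lambda>z. z powr \<nu> / \<nu>) has_field_derivative of_real s powr (\<nu> - 1)) (at (complex_of_real s))"
      using s \<nu> by (auto intro!: derivative_eq_intros simp: complex_nonpos_Reals_iff)
    also have "of_real s powr (\<nu> - 1) = of_real s powr (- \<mu> - 1) * complex_of_real s ^ n"
    proof -
      have "\<nu> - 1 = (- \<mu> - 1) + of_nat n" by (simp add: \<nu>_def)
      then have "complex_of_real s powr (\<nu> - 1) = of_real s powr (- \<mu> - 1) * of_real s powr of_nat n"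
        by (simp only: powr_add)
      then show ?thesis using s by (simp add: powr_nat')
    qed
    finally show "((\<lambda>s. complex_of_real s powr \<nu> / \<nu>) has_vector_derivative
        of_real s powr (- \<mu> - 1) * complex_of_real s ^ n) (at s)"
      by (rule has_vector_derivative_real_field)
  qed simp
  then show "((\<lambda>s. of_real s powr (- \<mu> - 1) * of_real s ^ n) has_integral
      inverse (of_nat n - \<mu>)) {0..1::real}"
    by (simp add: \<nu>_def inverse_eq_divide)
qed auto

text \<open>Cauchy's formulas for the value and the derivative of \<open>z ^ n\<close> at 1, on the
  circle of radius \<open>c\<close>, obtained from explicit primitives and induction on
  \<open>n\<close>.\<close>

lemma has_integral_circle_powers:
  assumes "c \<noteq> 0"
  shows "((\<lambda>\<theta>. (1 + of_real c * exp (\<i> * of_real \<theta>)) ^ n) has_integral of_real (2 * pi)) {0..2*pi}"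
    and "((\<lambda>\<theta>. exp (- \<i> * of_real \<theta>) * (1 + of_real c * exp (\<i> * of_real \<theta>)) ^ n) has_integral
          of_real (2 * pi * c) * of_nat n) {0..2*pi}"
proof -
  define q where "q \<theta> = 1 + of_real c * exp (\<i> * of_real \<theta>)" for \<theta>
  have exp2pi: "exp (\<i> * of_real (2 * pi)) = 1" "exp (- \<i> * of_real (2 * pi)) = 1"
    using exp_two_pi_i by (simp_all add: mult_ac exp_minus)
  \<comment> \<open>Up to a constant factor, the integrand is the derivative of
    \<open>q \<theta> ^ Suc n\<close>, whose values at both ends agree.\<close>
  have 0: "((\<lambda>\<theta>. q \<theta> ^ n * exp (\<i> * of_real \<theta>)) has_integral 0) {0..2*pi}" for n
  proof -
    define F where "F z = (1 + of_real c * exp (\<i> * z)) ^ Suc n / (of_nat (Suc n) * \<i> * of_real c)" for z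
    have "((\<lambda>\<theta>. q \<theta> ^ n * exp (\<i> * of_real \<theta>)) has_integral (F (of_real (2 * pi)) - F (of_real 0))) {0..2*pi}"
    proof (rule fundamental_theorem_of_calculus)
      fix \<theta> :: real
      have "((\<lambda>z. 1 + of_real c * exp (\<i> * z)) has_field_derivative
          of_real c * (exp (\<i> * of_real \<theta>) * \<i>)) (at (of_real \<theta>))"
        by (auto intro!: derivative_eq_intros)
      from DERIV_cdivide[OF DERIV_power[OF this, of "Suc n"], of "of_nat (Suc n) * \<i> * of_real c"]
      have "(F has_field_derivative
          of_nat (Suc n) * (1 + of_real c * exp (\<i> * of_real \<theta>)) ^ n * (of_real c * (exp (\<i> * of_real \<theta>) * \<i>)) /
          (of_nat (Suc n) * \<i> * of_real c)) (at (of_real \<theta>))"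
        unfolding F_def by (simp add: mult_ac del: of_nat_Suc power_Suc)
      also have "of_nat (Suc n) * (1 + of_real c * exp (\<i> * of_real \<theta>)) ^ n * (of_real c * (exp (\<i> * of_real \<theta>) * \<i>)) /
          (of_nat (Suc n) * \<i> * of_real c) = q \<theta> ^ n * exp (\<i> * of_real \<theta>)"
        using assms by (simp add: q_def field_simps del: of_nat_Suc)
      finally show "((\<lambda>x. F (of_real x)) has_vector_derivative q \<theta> ^ n * exp (\<i> * of_real \<theta>)) (at \<theta> within {0..2*pi})"
        by (rule has_vector_derivative_real_field)
    qed simp
    then show ?thesis by (simp only: F_def exp2pi) simp
  qed
  \<comment> \<open>One further factor \<open>q\<close> adds \<open>c\<close> times the vanishing
    integral above.\<close>
  have 1: "((\<lambda>\<theta>. q \<theta> ^ n) has_integral of_real (2 * pi)) {0..2*pi}" for n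
  proof (induction n)
    case 0
    show ?case using has_integral_const_real[of "1 :: complex" 0 "2 * pi"] by (simp add: scaleR_conv_of_real)
  next
    case (Suc n)
    show ?case
      using has_integral_add[OF Suc has_integral_mult_right[OF 0, of "of_real c" n]]
      by (simp add: q_def algebra_simps)
  qed
  \<comment> \<open>Since \<open>exp (- \<i> * of_real \<theta>) * q \<theta>\<close> equals
    \<open>exp (- \<i> * of_real \<theta>) + of_real c\<close>, each induction step adds
    \<open>2 * pi * c\<close>.\<close>
  have 2: "((\<lambda>\<theta>. exp (- \<i> * of_real \<theta>) * q \<theta> ^ n) has_integral of_real (2 * pi * c) * of_nat n) {0..2*pi}" for n
  proof (induction n)
    case 0
    define F where "F z = exp (- \<i> * z) / (- \<i>)" for z
    have "((\<lambda>\<theta>. exp (- \<i> * of_real \<theta>)) has_integral (F (of_real (2 * pi)) - F (of_real 0))) {0..2*pi}"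
    proof (rule fundamental_theorem_of_calculus)
      fix \<theta> :: real
      have "(F has_field_derivative exp (- \<i> * of_real \<theta>)) (at (of_real \<theta>))"
        unfolding F_def by (auto intro!: derivative_eq_intros simp: mult.assoc)
      then show "((\<lambda>x. F (of_real x)) has_vector_derivative exp (- \<i> * of_real \<theta>)) (at \<theta> within {0..2*pi})"
        by (rule has_vector_derivative_real_field)
    qed simp
    then show ?case by (simp only: F_def exp2pi) simp
  next
    case (Suc n)
    have "exp (- \<i> * of_real \<theta>) * q \<theta> ^ Suc n = exp (- \<i> * of_real \<theta>) * q \<theta> ^ n + of_real c * q \<theta> ^ n" for \<theta>
    proof -
      have "exp (- \<i> * of_real \<theta>) * exp (\<i> * of_real \<theta>) = 1" by (simp flip: exp_add)
      then have "exp (- \<i> * of_real \<theta>) * q \<theta> = exp (- \<i> * of_real \<theta>) + of_real c"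
        by (simp add: q_def algebra_simps)
      then have "exp (- \<i> * of_real \<theta>) * q \<theta> * q \<theta> ^ n = (exp (- \<i> * of_real \<theta>) + of_real c) * q \<theta> ^ n"
        by (simp only:)
      then show ?thesis by (simp only: power_Suc mult.assoc distrib_right)
    qed
    then show ?case
      using has_integral_add[OF Suc has_integral_mult_right[OF 1, of "of_real c" n]]
      by (simp add: algebra_simps)
  qed
  show "((\<lambda>\<theta>. (1 + of_real c * exp (\<i> * of_real \<theta>)) ^ n) has_integral of_real (2 * pi)) {0..2*pi}"
    using 1 by (simp add: q_def)
  show "((\<lambda>\<theta>. exp (- \<i> * of_real \<theta>) * (1 + of_real c * exp (\<i> * of_real \<theta>)) ^ n) has_integral
          of_real (2 * pi * c) * of_nat n) {0..2*pi}"
    using 2 by (simp add: q_def)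
qed

text \<open>
  Cauchy's formula on the circle of radius \<open>c |t|\<close> around \<open>t\<close> expresses \<open>t f'(t) - \<mu> f(t)\<close> through
  the values \<open>f (q t)\<close> with \<open>q\<close> on a fixed small circle around \<open>1\<close>.
\<close>

lemma dir_growth_multiply:
  assumes v: "dir_growth k d v" and k: "k > 0"
  shows "dir_growth k d (\<lambda>n. (of_nat n - \<mu>) *\<^sub>C v n)"
proof -
  obtain \<alpha> r where \<alpha>r: "\<alpha> > 0" "r > 0" and g: "fps_exp_growth k d \<alpha> r (Abs_fps v)"
    using v by (auto simp: dir_growth_def)
  \<comment> \<open>The bound \<open>\<alpha> / 8\<close> widens the opening
    \<open>\<alpha> / 4\<close> to exactly \<open>\<alpha> / 2\<close>; \<open>c < 1\<close> keeps
    the modulus of \<open>q\<close> below 2, so the disc radius \<open>r / 4\<close> grows to at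
    most \<open>r / 2\<close>.\<close>
  obtain c where c: "0 < c" "c < 1" "\<And>\<zeta>. cmod (\<zeta> - 1) \<le> c \<Longrightarrow> \<zeta> \<noteq> 0 \<and> \<bar>Arg \<zeta>\<bar> \<le> \<alpha> / 8"
    using small_Arg_near_one[of "\<alpha> / 8"] \<alpha>r by auto
  define q where "q \<theta> = 1 + of_real c * exp (\<i> * of_real \<theta>)" for \<theta>
  \<comment> \<open>The two terms are normalised so that their integrals against
    \<open>q \<theta> ^ n\<close> are \<open>n\<close> and \<open>\<mu>\<close>.\<close>
  define a where "a \<theta> = exp (- \<i> * of_real \<theta>) / of_real (2 * pi * c) - \<mu> / of_real (2 * pi)" for \<theta>
  have "fps_exp_growth k d (\<alpha> / 4) (r / 4) (Abs_fps (\<lambda>n. (of_nat n - \<mu>) *\<^sub>C v n))"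
  proof (rule fps_exp_growth_kernel[OF g k, where \<beta> = "\<alpha> / 2" and \<rho> = "r / 2"
        and lo = 0 and hi = "2 * pi" and a = a and q = q])
    show "continuous_on {0..2 * pi} a" unfolding a_def using c by (intro continuous_intros) auto
    show "continuous_on {0..2 * pi} q" unfolding q_def by (intro continuous_intros)
    fix \<theta> t assume t: "t \<in> disc_sector d (\<alpha> / 4) (r / 4)"
    have "cmod (q \<theta> - 1) \<le> c" using c by (simp add: q_def norm_mult)
    note Arg_q = c(3)[OF this]
    show "q \<theta> * t \<in> disc_sector d (\<alpha> / 2) (r / 2)"
    proof (cases "t \<in> ball 0 (r / 4)")
      case True
      have "cmod (q \<theta>) \<le> 1 + c"
        using norm_triangle_ineq[of 1 "of_real c * exp (\<i> * of_real \<theta>)"] c by (simp add: q_def norm_mult)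
      then have "cmod (q \<theta> * t) \<le> 2 * cmod t"
        unfolding norm_mult using c by (intro mult_right_mono) auto
      then show ?thesis using True by (simp add: disc_sector_def)
    next
      case False
      then have "q \<theta> * t \<in> sector d (\<alpha> / 4 + 2 * (\<alpha> / 8))"
        using Arg_q t by (intro sector_mult) (auto simp: disc_sector_def)
      then show ?thesis by (simp add: disc_sector_def)
    qed
  next
    fix n
    have "((\<lambda>\<theta>. exp (- \<i> * of_real \<theta>) * q \<theta> ^ n / of_real (2 * pi * c) - \<mu> / of_real (2 * pi) * q \<theta> ^ n)
        has_integral (of_real (2 * pi * c) * of_nat n / of_real (2 * pi * c) - \<mu> / of_real (2 * pi) * of_real (2 * pi))) {0..2*pi}"
      unfolding q_def using c
      by (intro has_integral_diff has_integral_divide has_integral_mult_right has_integral_circle_powers) auto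
    also have "of_real (2 * pi * c) * of_nat n / of_real (2 * pi * c) - \<mu> / of_real (2 * pi) * of_real (2 * pi) = of_nat n - \<mu>"
      using c by simp
    finally show "((\<lambda>\<theta>. a \<theta> * q \<theta> ^ n) has_integral of_nat n - \<mu>) {0..2*pi}"
      by (simp add: a_def algebra_simps)
  qed (use \<alpha>r in auto)
  then show ?thesis using \<alpha>r by (auto intro: dir_growthI)
qed

section \<open>Difference quotients and the shift of coefficients\<close>

text \<open>When \<open>v\<close> lists the Taylor coefficients of \<open>f\<close> at 0,
  \<open>v 0\<close> is \<open>f 0\<close> and \<open>v 1\<close> is the value that removes the
  singularity.\<close>

definition difference_quotient :: "(complex \<Rightarrow> 'e::complex_banach) \<Rightarrow> (nat \<Rightarrow> 'e) \<Rightarrow> complex \<Rightarrow> 'e"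
  where "difference_quotient f v t = (if t = 0 then v 1 else (1 / t) *\<^sub>C (f t - v 0))"

lemma sums_scaleC_power_Suc_iff:
  "(\<lambda>n. t ^ Suc n *\<^sub>C v (Suc n)) sums (s - v 0) \<longleftrightarrow> (\<lambda>n. t ^ n *\<^sub>C v n) sums (s :: 'e::complex_banach)"
  using sums_Suc_iff[of "\<lambda>n. t ^ n *\<^sub>C v n" "s - v 0"] by simp

lemma sums_difference_quotient:
  fixes v :: "nat \<Rightarrow> 'e::complex_banach"
  assumes sums: "(\<lambda>n. t ^ n *\<^sub>C v n) sums f t"
  shows "(\<lambda>n. t ^ n *\<^sub>C v (Suc n)) sums difference_quotient f v t"
proof (cases "t = 0")
  case True
  have "(\<lambda>n. if n = 0 then v (Suc n) else 0) sums v (Suc 0)" by (rule sums_single)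
  also have "(\<lambda>n. if n = 0 then v (Suc n) else 0) = (\<lambda>n. t ^ n *\<^sub>C v (Suc n))"
    using True by (auto simp: fun_eq_iff power_0_left scaleC.zero_left)
  finally show ?thesis using True by (simp add: difference_quotient_def)
next
  case False
  have "(\<lambda>n. t ^ Suc n *\<^sub>C v (Suc n)) sums (f t - v 0)"
    using sums unfolding sums_scaleC_power_Suc_iff .
  then have "(\<lambda>n. (1 / t) *\<^sub>C t ^ Suc n *\<^sub>C v (Suc n)) sums ((1 / t) *\<^sub>C (f t - v 0))"
    by (rule bounded_linear.sums[OF scaleC.bounded_linear_right])
  then show ?thesis using False by (simp add: difference_quotient_def scaleC_scaleC)
qed

text \<open>With \<open>x = cmod t / \<tau> \<le> 1 / 2\<close>, the term of index
  \<open>Suc n\<close> is at most \<open>M * x ^ Suc n\<close>, hence at most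
  \<open>M * x * (1 / 2) ^ n\<close>. Applied to a difference quotient, this controls second-order
  remainders at 0.\<close>

lemma power_series_first_order:
  fixes v :: "nat \<Rightarrow> 'e::complex_banach"
  assumes "\<epsilon> > 0" and sums: "\<And>t. t \<in> ball 0 \<epsilon> \<Longrightarrow> (\<lambda>n. t ^ n *\<^sub>C v n) sums f t"
  obtains C \<delta> where "C > 0" "\<delta> > 0" "\<And>t. cmod t < \<delta> \<Longrightarrow> norm (f t - v 0) \<le> C * cmod t"
proof -
  obtain M \<tau> where M: "M > 0" "\<tau> > 0" "\<tau> < \<epsilon>" "\<And>n. \<tau> ^ n * norm (v n) \<le> M"
    by (rule power_series_coeff_bound[OF assms]) auto
  have "norm (f t - v 0) \<le> 2 * M / \<tau> * cmod t" if t: "cmod t < \<tau> / 2" for t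
  proof -
    define x where "x = cmod t / \<tau>"
    have x: "0 \<le> x" "x \<le> 1 / 2" using t M by (auto simp: x_def field_simps)
    have "(\<lambda>n. t ^ n *\<^sub>C v n) sums f t" using t M by (intro sums) auto
    then have s1: "(\<lambda>n. t ^ Suc n *\<^sub>C v (Suc n)) sums (f t - v 0)"
      unfolding sums_scaleC_power_Suc_iff .
    have s2: "(\<lambda>n. M * x * (1 / 2) ^ n) sums (M * x * 2)"
      using sums_mult[OF geometric_sums[of "1/2 :: real"], of "M * x"] by simp
    have "norm (t ^ Suc n *\<^sub>C v (Suc n)) \<le> M * x * (1 / 2) ^ n" for n
    proof -
      have "norm (t ^ Suc n *\<^sub>C v (Suc n)) = x ^ Suc n * (\<tau> ^ Suc n * norm (v (Suc n)))"
        using M(2) by (simp add: norm_scaleC norm_mult norm_power x_def power_divide)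
      also have "\<dots> \<le> x ^ Suc n * M" using M(4)[of "Suc n"] x(1) by (intro mult_left_mono) auto
      also have "\<dots> \<le> (x * (1 / 2) ^ n) * M"
        using x M(1) power_mono[OF x(2,1), of n] by (intro mult_right_mono) (auto simp: mult_left_mono)
      finally show ?thesis by (simp add: mult_ac)
    qed
    then have "norm (\<Sum>n. t ^ Suc n *\<^sub>C v (Suc n)) \<le> (\<Sum>n. M * x * (1 / 2) ^ n)"
      by (rule norm_suminf_le[OF _ sums_summable[OF s2]])
    then have "norm (f t - v 0) \<le> M * x * 2"
      by (simp only: sums_unique[OF s1, symmetric] sums_unique[OF s2, symmetric])
    then show ?thesis by (simp add: x_def mult_ac)
  qed
  then show thesis using M by (intro that[of "2 * M / \<tau>" "\<tau> / 2"]) auto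
qed

text \<open>Away from 0 the product rule suffices. At 0 the derivative is the coefficient of index
  2, because the remainder is \<open>t\<close> times the deviation of the second difference quotient
  from that coefficient.\<close>

lemma vholomorphic_difference_quotient:
  fixes v :: "nat \<Rightarrow> 'e::complex_banach"
  assumes f: "f vholomorphic_on S" and "open S"
    and "\<epsilon> > 0" and sums: "\<And>t. t \<in> ball 0 \<epsilon> \<Longrightarrow> (\<lambda>n. t ^ n *\<^sub>C v n) sums f t"
  shows "difference_quotient f v vholomorphic_on S"
  unfolding vholomorphic_on_def
proof
  define h where "h = difference_quotient f v"
  fix z assume z: "z \<in> S"
  have "\<exists>D. (h has_derivative (\<lambda>x. x *\<^sub>C D)) (at z)"
  proof (cases "z = 0")
    case False
    obtain D where D: "(f has_derivative (\<lambda>x. x *\<^sub>C D)) (at z)"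
      by (rule vholomorphic_onD[OF f \<open>open S\<close> z])
    define E where "E = (1 / z) *\<^sub>C D + (- (1 / z\<^sup>2)) *\<^sub>C (f z - v 0)"
    have "((\<lambda>t. 1 / t) has_derivative (\<lambda>x. x * - (1 / z\<^sup>2))) (at z)"
      using False by (auto intro!: derivative_eq_intros simp: power2_eq_square)
    from scaleC.FDERIV[OF this has_derivative_diff[OF D has_derivative_const[of "v 0"]]]
    have "((\<lambda>t. (1 / t) *\<^sub>C (f t - v 0)) has_derivative (\<lambda>x. x *\<^sub>C E)) (at z)"
      by (simp add: E_def scaleC_add_right scaleC_scaleC mult_ac)
    then have "(h has_derivative (\<lambda>x. x *\<^sub>C E)) (at z)"
      by (rule has_derivative_transform_within_open[where s = "- {0}"])
        (use False in \<open>auto simp: h_def difference_quotient_def\<close>)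
    then show ?thesis by (rule exI[where x = E])
  next
    case True
    define k where "k = difference_quotient h (\<lambda>n. v (Suc n))"
    have "(\<lambda>n. t ^ n *\<^sub>C v (Suc (Suc n))) sums k t" if "t \<in> ball 0 \<epsilon>" for t
      unfolding k_def h_def by (intro sums_difference_quotient sums that)
    then obtain C \<delta> where C: "C > 0" "\<delta> > 0"
      "\<And>t. cmod t < \<delta> \<Longrightarrow> norm (k t - v (Suc (Suc 0))) \<le> C * cmod t"
      using power_series_first_order[OF \<open>\<epsilon> > 0\<close>, of "\<lambda>n. v (Suc (Suc n))" k] by metis
    have "(h has_derivative (\<lambda>x. x *\<^sub>C v (Suc (Suc 0)))) (at 0)"
      unfolding has_derivative_at
    proof (intro conjI scaleC.bounded_linear_left)
      have "norm (norm (h (0 + t) - h 0 - t *\<^sub>C v (Suc (Suc 0))) / norm t) \<le> C * cmod t"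
        if "cmod t < \<delta>" "t \<noteq> 0" for t
      proof -
        have "h t - h 0 - t *\<^sub>C v (Suc (Suc 0)) = t *\<^sub>C (k t - v (Suc (Suc 0)))"
          using that by (simp add: k_def difference_quotient_def h_def scaleC.diff_right scaleC_scaleC)
        then show ?thesis using C(3)[OF that(1)] that(2) by (simp add: norm_scaleC)
      qed
      then have "\<forall>\<^sub>F t in at 0. norm (norm (h (0 + t) - h 0 - t *\<^sub>C v (Suc (Suc 0))) / norm t) \<le> C * cmod t"
        using C(2) unfolding eventually_at by (auto simp: dist_norm)
      moreover have "((\<lambda>t. C * cmod t) \<longlongrightarrow> 0) (at 0)"
        by (auto intro!: tendsto_eq_intros)
      ultimately show "(\<lambda>t. norm (h (0 + t) - h 0 - t *\<^sub>C v (Suc (Suc 0))) / norm t) \<midarrow>0\<rightarrow> 0"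
        by (rule Lim_null_comparison)
    qed
    then show ?thesis using True by (intro exI[where x = "v (Suc (Suc 0))"]) simp
  qed
  then show "\<exists>D. (difference_quotient f v has_derivative (\<lambda>x. x *\<^sub>C D)) (at z within S)"
    by (simp only: h_def at_within_open[OF z \<open>open S\<close>])
qed

text \<open>The quotient \<open>(f t - v 0) / t\<close> is bounded near 0 by its own power series;
  elsewhere the division costs at most a factor \<open>1 / \<delta>\<close>.\<close>

lemma fps_exp_growth_shift:
  fixes v :: "nat \<Rightarrow> 'e::complex_banach"
  assumes "fps_exp_growth k d \<alpha> r (Abs_fps v)"
  shows "fps_exp_growth k d \<alpha> r (Abs_fps (\<lambda>n. v (Suc n)))"
proof -
  obtain f \<epsilon> where f: "f \<in> exp_growth_holomorphic k d \<alpha> r" and "\<epsilon> > 0"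
    and sums: "\<And>t. t \<in> ball 0 \<epsilon> \<Longrightarrow> (\<lambda>n. t ^ n *\<^sub>C v n) sums f t"
    using assms by (auto simp: fps_exp_growth_def)
  define h where "h = difference_quotient f v"
  have sums_h: "(\<lambda>n. t ^ n *\<^sub>C v (Suc n)) sums h t" if "t \<in> ball 0 \<epsilon>" for t
    unfolding h_def by (intro sums_difference_quotient sums that)
  have "h vholomorphic_on disc_sector d \<alpha> r"
    unfolding h_def using f \<open>\<epsilon> > 0\<close> sums
    by (intro vholomorphic_difference_quotient open_disc_sector) (auto simp: exp_growth_holomorphic_def)
  moreover have "\<exists>A>0. \<exists>B>0. \<forall>t\<in>disc_sector d \<alpha>' r'. norm (h t) < A * exp (B * cmod t powr k)"
    if \<alpha>r: "\<alpha>' \<in> {0<..<\<alpha>}" "r' \<in> {0<..<r}" for \<alpha>' r'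
  proof -
    have "\<exists>A>0. \<exists>B>0. \<forall>t\<in>disc_sector d \<alpha>' r'. norm (f t) < A * exp (B * cmod t powr k)"
      using f \<alpha>r by (simp add: exp_growth_holomorphic_def)
    then obtain A B where AB: "A > 0" "B > 0"
      "\<And>t. t \<in> disc_sector d \<alpha>' r' \<Longrightarrow> norm (f t) < A * exp (B * cmod t powr k)" by blast
    obtain C \<delta> where C: "C > 0" "\<delta> > 0" "\<And>t. cmod t < \<delta> \<Longrightarrow> norm (h t - v (Suc 0)) \<le> C * cmod t"
      using power_series_first_order[OF \<open>\<epsilon> > 0\<close> sums_h] by metis
    define A1 where "A1 = norm (v (Suc 0)) + C * \<delta>"
    define A2 where "A2 = (A + norm (v 0)) / \<delta>"
    have A12: "A1 > 0" "A2 > 0" using C AB by (auto simp: A1_def A2_def add_nonneg_pos add_pos_nonneg)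
    have "norm (h t) < (A1 + A2) * exp (B * cmod t powr k)" if t: "t \<in> disc_sector d \<alpha>' r'" for t
    proof -
      define E where "E = exp (B * cmod t powr k)"
      have E: "1 \<le> E" using AB by (simp add: E_def)
      \<comment> \<open>\<open>A1\<close> serves the small \<open>t\<close> and \<open>A2\<close>
        the others; since both are positive, their sum makes the final bound strict.\<close>
      have "norm (h t) \<le> A1 * E \<or> norm (h t) \<le> A2 * E"
      proof (cases "cmod t < \<delta>")
        case True
        have "norm (h t) \<le> norm (v (Suc 0)) + norm (h t - v (Suc 0))"
          using norm_triangle_ineq[of "v (Suc 0)" "h t - v (Suc 0)"] by simp
        also have "\<dots> \<le> norm (v (Suc 0)) + C * \<delta>"
          using order_trans[OF C(3)[OF True], of "C * \<delta>"] True C(1) by simp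
        also have "\<dots> \<le> A1 * E" using E A12 by (simp flip: A1_def)
        finally show ?thesis by simp
      next
        case False
        then have t0: "t \<noteq> 0" "cmod t \<ge> \<delta>" using C(2) by auto
        have "norm (h t) = norm (f t - v 0) / cmod t"
          using t0 by (simp add: h_def difference_quotient_def norm_scaleC norm_divide)
        also have "\<dots> \<le> norm (f t - v 0) / \<delta>" using t0 C(2) by (intro divide_left_mono) auto
        also have "norm (f t - v 0) \<le> A * E + norm (v 0) * E"
          using norm_triangle_ineq4[of "f t" "v 0"] AB(3)[OF t] mult_left_mono[OF E, of "norm (v 0)"]
          by (simp add: E_def)
        finally have "norm (h t) \<le> A2 * E"
          using C(2) by (simp add: A2_def divide_right_mono algebra_simps)
        then show ?thesis by simp
      qed
      moreover have "A1 * E > 0" "A2 * E > 0" using A12 E by simp_all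
      ultimately have "norm (h t) < A1 * E + A2 * E" by linarith
      then show ?thesis by (simp add: E_def algebra_simps)
    qed
    moreover have "A1 + A2 > 0" using A12 by simp
    ultimately show ?thesis using AB(2) by blast
  qed
  ultimately have "h \<in> exp_growth_holomorphic k d \<alpha> r" by (simp add: exp_growth_holomorphic_def)
  then show ?thesis
    unfolding fps_exp_growth_def using \<open>\<epsilon> > 0\<close> sums_h
    by (intro bexI[of _ h] exI[of _ \<epsilon>]) auto
qed

lemma fps_exp_growth_unshift:
  fixes v :: "nat \<Rightarrow> 'e::complex_banach"
  assumes "fps_exp_growth k d \<alpha> r (Abs_fps (\<lambda>n. v (Suc n)))" and k: "k > 0"
  shows "fps_exp_growth k d \<alpha> r (Abs_fps v)"
proof -
  obtain h \<epsilon> where h: "h \<in> exp_growth_holomorphic k d \<alpha> r" and "\<epsilon> > 0"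
    and sums: "\<And>t. t \<in> ball 0 \<epsilon> \<Longrightarrow> (\<lambda>n. t ^ n *\<^sub>C v (Suc n)) sums h t"
    using assms by (auto simp: fps_exp_growth_def)
  define g where "g t = v 0 + t *\<^sub>C h t" for t
  have sums_g: "(\<lambda>n. t ^ n *\<^sub>C v n) sums g t" if t: "t \<in> ball 0 \<epsilon>" for t
  proof -
    have "(\<lambda>n. t *\<^sub>C t ^ n *\<^sub>C v (Suc n)) sums (t *\<^sub>C h t)"
      by (rule bounded_linear.sums[OF scaleC.bounded_linear_right sums[OF t]])
    then have "(\<lambda>n. t ^ Suc n *\<^sub>C v (Suc n)) sums (g t - v 0)"
      by (simp add: scaleC_scaleC g_def)
    then show ?thesis unfolding sums_scaleC_power_Suc_iff .
  qed
  have "g vholomorphic_on disc_sector d \<alpha> r"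
    unfolding vholomorphic_on_def
  proof
    fix z assume "z \<in> disc_sector d \<alpha> r"
    then have "\<exists>D. (h has_derivative (\<lambda>x. x *\<^sub>C D)) (at z within disc_sector d \<alpha> r)"
      using h by (simp add: exp_growth_holomorphic_def vholomorphic_on_def)
    then obtain D where D: "(h has_derivative (\<lambda>x. x *\<^sub>C D)) (at z within disc_sector d \<alpha> r)" ..
    from has_derivative_add[OF has_derivative_const[of "v 0"] scaleC.FDERIV[OF has_derivative_ident D]]
    have "(g has_derivative (\<lambda>x. x *\<^sub>C (z *\<^sub>C D + h z))) (at z within disc_sector d \<alpha> r)"
      by (simp add: g_def [abs_def] scaleC_add_right scaleC_scaleC mult.commute)
    then show "\<exists>D. (g has_derivative (\<lambda>x. x *\<^sub>C D)) (at z within disc_sector d \<alpha> r)"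
      by (rule exI[where x = "z *\<^sub>C D + h z"])
  qed
  moreover have "\<exists>A>0. \<exists>B>0. \<forall>t\<in>disc_sector d \<alpha>' r'. norm (g t) < A * exp (B * cmod t powr k)"
    if \<alpha>r: "\<alpha>' \<in> {0<..<\<alpha>}" "r' \<in> {0<..<r}" for \<alpha>' r'
  proof -
    have "\<exists>A>0. \<exists>B>0. \<forall>t\<in>disc_sector d \<alpha>' r'. norm (h t) < A * exp (B * cmod t powr k)"
      using h \<alpha>r by (simp add: exp_growth_holomorphic_def)
    then obtain A B where AB: "A > 0" "B > 0"
      "\<And>t. t \<in> disc_sector d \<alpha>' r' \<Longrightarrow> norm (h t) < A * exp (B * cmod t powr k)" by blast
    have "norm (g t) < (norm (v 0) + A) * exp ((B + 1 / k) * cmod t powr k)" if t: "t \<in> disc_sector d \<alpha>' r'" for t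
    proof -
      \<comment> \<open>The extra factor \<open>t\<close> is absorbed by the exponential:
        \<open>ln y \<le> y - 1\<close> at \<open>y = cmod t powr k\<close>. This raises
        \<open>B\<close> to \<open>B + 1 / k\<close>.\<close>
      have "cmod t \<le> exp (1 / k * cmod t powr k)"
      proof (cases "t = 0")
        case False
        have "k * ln (cmod t) \<le> cmod t powr k"
          using ln_le_minus_one[of "cmod t powr k"] False by (simp add: ln_powr)
        then have "ln (cmod t) \<le> 1 / k * cmod t powr k" using k by (simp add: field_simps)
        then show ?thesis using False by (metis exp_le_cancel_iff exp_ln zero_less_norm_iff)
      qed simp
      then have "norm (t *\<^sub>C h t) \<le> exp (1 / k * cmod t powr k) * norm (h t)"
        unfolding norm_scaleC by (rule mult_right_mono) simp
      also have "\<dots> < exp (1 / k * cmod t powr k) * (A * exp (B * cmod t powr k))"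
        using AB(3)[OF t] by simp
      also have "\<dots> = A * exp ((B + 1 / k) * cmod t powr k)"
        by (simp add: exp_add algebra_simps)
      finally have "norm (t *\<^sub>C h t) < A * exp ((B + 1 / k) * cmod t powr k)" .
      moreover have "norm (v 0) * 1 \<le> norm (v 0) * exp ((B + 1 / k) * cmod t powr k)"
        using AB(2) k by (intro mult_left_mono) auto
      ultimately show ?thesis
        unfolding g_def using norm_triangle_ineq[of "v 0" "t *\<^sub>C h t"] by (simp add: algebra_simps)
    qed
    moreover have "norm (v 0) + A > 0" "B + 1 / k > 0" using AB k by (auto simp: add_nonneg_pos)
    ultimately show ?thesis by blast
  qed
  ultimately have "g \<in> exp_growth_holomorphic k d \<alpha> r" by (simp add: exp_growth_holomorphic_def)
  then show ?thesis
    unfolding fps_exp_growth_def using \<open>\<epsilon> > 0\<close> sums_g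
    by (intro bexI[of _ g] exI[of _ \<epsilon>]) auto
qed

section \<open>From linear factors to polynomials\<close>

lemma dir_growth_Suc_iff:
  assumes "k > 0"
  shows "dir_growth k d (\<lambda>n. v (Suc n)) \<longleftrightarrow> dir_growth k d v"
  unfolding dir_growth_def using fps_exp_growth_shift fps_exp_growth_unshift[of k d _ _ v] assms by (intro iffI) fast+

text \<open>Dropping the first coefficient turns the root \<open>\<mu>\<close> into
  \<open>\<mu> - 1\<close>, so finitely many shifts reach the half plane treated before.\<close>

lemma dir_growth_divide:
  assumes v: "dir_growth k d v" and k: "k > 0" and \<mu>: "\<And>n. of_nat n \<noteq> \<mu>"
  shows "dir_growth k d (\<lambda>n. inverse (of_nat n - \<mu>) *\<^sub>C v n)"
proof -
  obtain N where "Re \<mu> + 1 < real N" using reals_Archimedean2 by blast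
  then show ?thesis using v \<mu>
  proof (induction N arbitrary: \<mu> v)
    case 0
    then show ?case by (intro dir_growth_divide_left_half_plane k) auto
  next
    case (Suc N)
    have "of_nat n \<noteq> \<mu> - 1" for n using Suc.prems(3)[of "Suc n"] by auto
    moreover have "dir_growth k d (\<lambda>n. v (Suc n))" using Suc.prems(2) by (simp add: dir_growth_Suc_iff[OF k])
    ultimately have "dir_growth k d (\<lambda>n. inverse (of_nat n - (\<mu> - 1)) *\<^sub>C v (Suc n))"
      using Suc.prems(1) by (intro Suc.IH) auto
    also have "(\<lambda>n. inverse (of_nat n - (\<mu> - 1)) *\<^sub>C v (Suc n)) = (\<lambda>n. inverse (of_nat (Suc n) - \<mu>) *\<^sub>C v (Suc n))"
      by (simp add: algebra_simps)
    \<comment> \<open>The claim is known for the shifted quotient sequence; restoring its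
      coefficient of index 0 does not affect growth.\<close>
    finally show ?case by (subst (asm) dir_growth_Suc_iff[OF k])
  qed
qed

text \<open>Induction over the roots of \<open>w\<close>. No factor vanishes at a natural number, so
  each can be multiplied or divided away separately; \<open>v\<close> is generalised because the
  factors act one after another.\<close>

lemma dir_growth_poly:
  assumes "dir_growth k d v" and k: "k > 0" and "\<And>n. poly w (of_nat n) \<noteq> 0"
  shows "dir_growth k d (\<lambda>n. poly w (of_nat n) *\<^sub>C v n)"
    and "dir_growth k d (\<lambda>n. inverse (poly w (of_nat n)) *\<^sub>C v n)"
proof -
  have "dir_growth k d (\<lambda>n. poly w (of_nat n) *\<^sub>C v n) \<and>
    dir_growth k d (\<lambda>n. inverse (poly w (of_nat n)) *\<^sub>C v n)"
    using assms(1,3)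
  proof (induction w arbitrary: v rule: poly_root_induct[where P = "\<lambda>_. True"])
    case 0
    then show ?case by simp
  next
    case (no_roots p)
    \<comment> \<open>By the fundamental theorem of algebra the induction ends at a constant
      polynomial.\<close>
    then have "degree p = 0" using alg_closed_imp_poly_has_root[of p] by auto
    then obtain c where "p = [:c:]" by (rule degree_eq_zeroE)
    then show ?case using dir_growth_scaleC[OF no_roots(2) k] by simp
  next
    case (root a p)
    have a: "of_nat n \<noteq> a" and p: "poly p (of_nat n) \<noteq> 0" for n
      using root.prems(2)[of n] by auto
    \<comment> \<open>The induction rule splits off \<open>a - z\<close>; the sign is treated as one
      more scalar factor.\<close>
    have eq: "poly ([:a, -1:] * p) z = -1 * (poly p z * (z - a))" for z by (simp add: algebra_simps)
    show ?case
      unfolding eq inverse_mult_distrib scaleC_scaleC[symmetric]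
      by (intro conjI dir_growth_scaleC[OF _ k] root.IH[THEN conjunct1] root.IH[THEN conjunct2] p
          dir_growth_multiply[OF _ k] dir_growth_divide[OF _ k a] root.prems(1))
  qed
  then show "dir_growth k d (\<lambda>n. poly w (of_nat n) *\<^sub>C v n)"
    "dir_growth k d (\<lambda>n. inverse (poly w (of_nat n)) *\<^sub>C v n)" by auto
qed

theorem theorem8:
  fixes p :: nat and w :: "complex poly" and m :: "nat \<Rightarrow> real"
  assumes "1 \<le> p"
    and "degree w = p"
    and "\<And>n :: nat. poly w (of_nat n) \<in> \<real> \<and> 0 < Re (poly w (of_nat n))"
    and "poly w 0 = 1"
    and "\<And>n. complex_of_real (m n) = poly w (of_nat n)"
  shows "preserves_summability TYPE('e::complex_banach) m"
proof -
  have m: "m n > 0" for n using assms(3)[of n] by (simp flip: assms(5))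
  have w: "poly w (of_nat n) \<noteq> 0" for n using m[of n] by (simp flip: assms(5))
  have "summable_dir k d u \<longleftrightarrow> summable_dir k d (moment_borel m u)" if k: "k > 0" for k d and u :: "'e fps"
  proof -
    \<comment> \<open>Both Borel operators act coefficientwise and therefore commute:
      \<open>y\<close> belongs to \<open>u\<close>, and \<open>x\<close>, which is \<open>y\<close>
      divided by the values of \<open>w\<close>, belongs to \<open>moment_borel m u\<close>.\<close>
    define y where "y n = (1 / Gamma (1 + real n / k)) *\<^sub>R fps_nth u n" for n
    define x where "x n = inverse (poly w (of_nat n)) *\<^sub>C y n" for n
    have u: "summable_dir k d u \<longleftrightarrow> dir_growth k d y"
      by (simp add: summable_dir_def dir_growth_def moment_borel_def y_def[abs_def])
    have "(1 / Gamma (1 + real n / k)) *\<^sub>R (1 / m n) *\<^sub>R fps_nth u n = x n" for n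
      by (simp add: x_def y_def flip: assms(5)) (simp add: scaleC_of_real divide_inverse mult_ac flip: of_real_inverse)
    then have mu: "summable_dir k d (moment_borel m u) \<longleftrightarrow> dir_growth k d x"
      by (simp add: summable_dir_def dir_growth_def moment_borel_def)
    have y: "y = (\<lambda>n. poly w (of_nat n) *\<^sub>C x n)"
      using w by (simp add: x_def scaleC_scaleC)
    show ?thesis
    proof
      assume "summable_dir k d u"
      then show "summable_dir k d (moment_borel m u)"
        unfolding u mu x_def[abs_def] by (rule dir_growth_poly(2)[OF _ k w])
    next
      assume "summable_dir k d (moment_borel m u)"
      then show "summable_dir k d u"
        unfolding u mu using dir_growth_poly(1)[OF _ k w, of d x] by (simp only: y[symmetric])
    qed
  qed
  then show ?thesis using m unfolding preserves_summability_def by blast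
qed

end
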